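(* For $q\in\mathbb{C}$ with $|q|<1$, $$\sum_{i,j\ge0}\frac{q^{i^2+2ij+j}}{(q;q)_{2i}(q;q)_{2j}}=\frac{1}{(q;q^2)_\infty^2(q^{4},q^{8},q^{20},q^{24};q^{28})_\infty},$$ $$\sum_{i,j\ge0}\frac{q^{i^2+2ij+i+j}}{(q;q)_{2i}(q;q)_{2j+1}}=\frac{(q^{8},q^{20},q^{14},q^{28};q^{28})_\infty}{(q;q)_\infty(q,q^{7},q^{10},q^{13},q^{15},q^{18},q^{21},q^{27};q^{28})_\infty},$$ $$\sum_{i,j\ge0}\frac{q^{i^2+2ij+i+j}}{(q;q)_{2i}(q;q)_{2j}}=\frac{(q^{4},q^{24},q^{14},q^{28};q^{28})_\infty}{(q;q)_\infty(q^{2},q^{3},q^{7},q^{11},q^{17},q^{21},q^{25},q^{26};q^{28})_\infty},$$ $$\sum_{i,j\ge0}\frac{q^{i^2+2ij+2i+j}}{(q;q)_{2i}(q;q)_{2j+1}}=\frac{1}{(q;q^2)_\infty^2(q^{4},q^{12},q^{16},q^{24};q^{28})_\infty},$$ $$\sum_{i,j\ge0}\frac{q^{i^2+2ij+i+3j}}{(q;q)_{2i+1}(q;q)_{2j}}=\frac{(q^{12},q^{16},q^{14},q^{28};q^{28})_\infty}{(q;q)_\infty(q^{5},q^{6},q^{7},q^{9},q^{19},q^{21},q^{22},q^{23};q^{28})_\infty},$$ $$\sum_{i,j\ge0}\frac{q^{i^2+2ij+2i+3j}}{(q;q)_{2i+1}(q;q)_{2j+1}}=\frac{1}{(q;q^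2)_\infty^2(q^{8},q^{12},q^{16},q^{20};q^{28})_\infty}.$$
   Context: For $|q|<1$: $(a;q)_\infty=\prod_{k\ge0}(1-aq^k)$; for integers $n\ge0$, $(a;q)_n=\prod_{k=0}^{n-1}(1-aq^k)$; and $(a_1,\dots,a_m;q)_\infty=\prod_{k=1}^m(a_k;q)_\infty$. *)

theory Defs
  imports "HOL-Analysis.Analysis"
begin

definition qpoch :: "complex \<Rightarrow> complex \<Rightarrow> nat \<Rightarrow> complex" where
  "qpoch a q n = (\<Prod>k<n. 1 - a * q ^ k)"

definition qpoch_inf :: "complex \<Rightarrow> complex \<Rightarrow> complex" where
  "qpoch_inf a q = (\<Prod>k. 1 - a * q ^ k)"

text \<open>The multi-parameter symbol \<open>(a\<^sub>1, \<dots>, a\<^sub>m; q)\<^sub>\<infinity>\<close>.\<close>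

definition qpochs_inf :: "complex list \<Rightarrow> complex \<Rightarrow> complex" where
  "qpochs_inf as q = (\<Prod>a\<leftarrow>as. qpoch_inf a q)"

text \<open>The infinite product always converges in the range considered, even if some
  factor vanishes, so \<^const>\<open>prodinf\<close> is not an arbitrary default value there.\<close>

lemma qpoch_inf_has_prod:
  assumes "norm q < 1"
  shows "(\<lambda>k. 1 - a * q ^ k) has_prod qpoch_inf a q"
proof -
  have "summable (\<lambda>k. norm (- (a * q ^ k)))"
    using assms by (simp add: norm_mult norm_power summable_mult summable_geometric)
  then have "convergent_prod (\<lambda>k. 1 + - (a * q ^ k))"
    by (intro abs_convergent_prod_imp_convergent_prod summable_imp_abs_convergent_prod) simp
  then show ?thesis
    unfolding qpoch_inf_def by (simp add: convergent_prod_has_prod)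
qed

end

theory Submission
  imports Defs
begin

text \<open>
  Put \<open>q = p\<^sup>2\<close>. By Euler, summing \<open>z ^ m / (q; q)\<^sub>m\<close> over all \<open>m\<close> gives \<open>1 / (z; q)\<^sub>\<infinity>\<close>, and the inner sums
  over \<open>2 j\<close> and \<open>2 j + 1\<close> are its even and odd parts at \<open>z = p q ^ i\<close> or \<open>z = p q ^ (i + 1)\<close>. Hence the six
  double sums are the even and odd parts in \<open>p\<close> of the three Rogers--Selberg sums, which equal
  \<open>(p ^ c, p ^ (7 - c), p ^ 7; p ^ 7)\<^sub>\<infinity> / (p; p)\<^sub>\<infinity>\<close> for \<open>c = 3, 5, 6\<close>. The Rogers--Selberg identities follow from
  Bailey's lemma and the Jacobi triple product, both of which reduce to the Durfee rectangle identity.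
  Finally, up to a function of \<open>p\<^sup>2\<close>, each product is a product of two theta functions in base \<open>p ^ 14\<close>,
  whose even and odd parts come from splitting the double theta series by parity.
\<close>

text \<open>The cross term 2 i j is i m at m = 2 j, so only the parity restriction on m keeps the
  inner sum from being Euler's series; a square root p of q encodes that parity in the sign of p.
  Summing over m leaves 1 / (p q^i; q)_inf = (p; q)_i / (p; q)_inf, and (p; q)_i / (q; q)_{2 i} = 1
  / ((q; q)_i (-p; p)_{2 i}) is the Rogers--Selberg summand in base p. Modulus 7 comes from a weight
  with exponent r (3 r - 1) / 2 in p: Bailey's lemma multiplies it by q^(r^2) = p^(2 r^2), which
  makes the quadratic coefficient 7 / 2. The remaining obstacle is that 1 / (p; p)_inf mixes both
  parities. After cancellation exactly four factors of odd residue modulo 14 remain, in two pairs c,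
  14 - c, and this is why a product of just two theta functions is enough. Sums are unconditional
  throughout, so every rearrangement rests on absolute summability.\<close>

lemma has_sum_times:
  fixes f :: "'a \<Rightarrow> complex" and g :: "'b \<Rightarrow> complex"
  assumes f: "(f has_sum a) A" and g: "(g has_sum b) B"
  shows "((\<lambda>(x, y). f x * g y) has_sum a * b) (A \<times> B)"
proof (rule has_sum_SigmaI)
  show "((\<lambda>y. case (x, y) of (x, y) \<Rightarrow> f x * g y) has_sum f x * b) B" for x
    using has_sum_cmult_right[OF g, of "f x"] by simp
  show "((\<lambda>x. f x * b) has_sum a * b) A"
    by (rule has_sum_cmult_left[OF f])
  \<comment> \<open>Joint summability is the real content. Over the complex numbers unconditional
    and absolute summability agree, so each factor supplies summable norms.\<close>
  have nf: "(\<lambda>x. norm (f x)) summable_on A" and ng: "(\<lambda>x. norm (g x)) summable_on B"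
    using f g summable_on_iff_abs_summable_on_complex has_sum_imp_summable by blast+
  have "(\<lambda>z. norm (case z of (x, y) \<Rightarrow> f x * g y)) summable_on A \<times> B"
  proof (rule summable_on_SigmaI)
    show "((\<lambda>y. norm (case (x, y) of (x, y) \<Rightarrow> f x * g y)) has_sum norm (f x) * (\<Sum>\<^sub>\<infinity>y\<in>B. norm (g y))) B" for x
      using has_sum_cmult_right[OF has_sum_infsum[OF ng], of "norm (f x)"] by (simp add: norm_mult)
    show "(\<lambda>x. norm (f x) * (\<Sum>\<^sub>\<infinity>y\<in>B. norm (g y))) summable_on A"
      by (rule summable_on_cmult_left[OF nf])
  qed auto
  then show "(\<lambda>(x, y). f x * g y) summable_on A \<times> B"
    by (rule abs_summable_summable)
qed

text \<open>Supplies the joint summability in \<open>bailey_lemma\<close> and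
  \<open>euler_double_sum\<close>, where the majorant separates into one factor per
  variable.\<close>

lemma summable_on_times_bound:
  fixes f :: "'a \<times> 'b \<Rightarrow> complex" and g :: "'a \<Rightarrow> real" and h :: "'b \<Rightarrow> real"
  assumes g: "g summable_on A" and h: "h summable_on B"
    and le: "\<And>x y. x \<in> A \<Longrightarrow> y \<in> B \<Longrightarrow> norm (f (x, y)) \<le> g x * h y"
    and h0: "\<And>y. y \<in> B \<Longrightarrow> h y \<ge> 0" and g0: "\<And>x. x \<in> A \<Longrightarrow> g x \<ge> 0"
  shows "f summable_on A \<times> B"
proof -
  have "(\<lambda>z. g (fst z) * h (snd z)) summable_on A \<times> B"
  proof (rule summable_on_SigmaI)
    show "((\<lambda>y. g (fst (x, y)) * h (snd (x, y))) has_sum g x * (\<Sum>\<^sub>\<infinity>y\<in>B. h y)) B" for x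
      using has_sum_cmult_right[OF has_sum_infsum[OF h]] by simp
    show "(\<lambda>x. g x * (\<Sum>\<^sub>\<infinity>y\<in>B. h y)) summable_on A"
      by (rule summable_on_cmult_left[OF g])
  qed (use h0 g0 in auto)
  then have "(\<lambda>z. norm (f z)) summable_on A \<times> B"
    by (rule Infinite_Sum.abs_summable_on_comparison_test') (clarsimp simp: le)
  then show ?thesis
    by (rule abs_summable_summable)
qed

subsection \<open>Euler's identities\<close>

lemma qpoch_0 [simp]: "qpoch a q 0 = 1"
  and qpoch_Suc: "qpoch a q (Suc n) = qpoch a q n * (1 - a * q ^ n)"
  by (simp_all add: qpoch_def)

lemma qpoch_tendsto:
  assumes "norm q < 1"
  shows "qpoch a q \<longlonglongrightarrow> qpoch_inf a q"
  using has_prod_imp_tendsto'[OF qpoch_inf_has_prod[OF assms]] by (simp add: qpoch_def[abs_def])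

lemma one_minus_mult_power_nonzero:
  fixes a q :: complex
  assumes "norm a < 1" "norm q < 1"
  shows "1 - a * q ^ k \<noteq> 0"
proof -
  have "norm (a * q ^ k) \<le> norm a * 1"
    unfolding norm_mult norm_power using assms by (intro mult_left_mono power_le_one) auto
  then show ?thesis using assms by auto
qed

lemma qpoch_nonzero:
  assumes "norm a < 1" "norm q < 1"
  shows "qpoch a q n \<noteq> 0"
  unfolding qpoch_def using one_minus_mult_power_nonzero[OF assms] by auto

lemma qpoch_inf_nonzero:
  assumes "norm a < 1" "norm q < 1"
  shows "qpoch_inf a q \<noteq> 0"
  using has_prod_eq_0_iff[OF qpoch_inf_has_prod[OF assms(2), of a]]
    one_minus_mult_power_nonzero[OF assms] by auto

text \<open>The reciprocals converge because the infinite product is nonzero. Later majorants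
  replace reciprocal q-factorials by this \<open>K\<close>.\<close>

lemma inverse_qpoch_bounded:
  assumes "norm a < 1" "norm q < 1"
  obtains K where "K > 0" "\<And>n. norm (1 / qpoch a q n) \<le> K"
proof -
  have "(\<lambda>n. 1 / qpoch a q n) \<longlonglongrightarrow> 1 / qpoch_inf a q"
    by (intro tendsto_intros qpoch_tendsto qpoch_inf_nonzero assms)
  then have "Bseq (\<lambda>n. 1 / qpoch a q n)"
    by (intro convergent_imp_Bseq convergentI)
  then show ?thesis
    using that by (auto simp: Bseq_def)
qed

text \<open>Continuity of a power series at 0, along the points reached by iterating a q-difference
  equation; it evaluates the limit of that iteration.\<close>

lemma suminf_tendsto_at_powers:
  fixes c :: "nat \<Rightarrow> complex"
  assumes q: "norm q < 1" and c: "summable (\<lambda>k. norm (c k * z ^ k))"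
  shows "(\<lambda>n. \<Sum>k. c k * (z * q ^ n) ^ k) \<longlonglongrightarrow> c 0"
proof -
  let ?b = "\<lambda>k. if k = 0 then c 0 else 0"
  have "((\<lambda>n. \<Sum>k. c k * (z * q ^ n) ^ k) \<longlonglongrightarrow> suminf ?b)"
  proof (rule tannerys_theorem[where M = "\<lambda>k. norm (c k * z ^ k)", THEN conjunct2, THEN conjunct2])
    show "(\<lambda>n. c k * (z * q ^ n) ^ k) \<longlonglongrightarrow> ?b k" for k
    proof (cases "k = 0")
      case False
      have "(\<lambda>n. c k * (z * q ^ n) ^ k) \<longlonglongrightarrow> c k * (z * 0) ^ k"
        by (intro tendsto_intros LIMSEQ_power_zero q)
      then show ?thesis using False by (simp add: zero_power)
    qed simp
    have "norm (c k * (z * q ^ n) ^ k) \<le> norm (c k * z ^ k)" for k n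
      using mult_left_mono[OF power_le_one[of "norm q" "n * k"], of "norm (c k) * norm z ^ k"] q
      by (simp add: norm_mult norm_power power_mult_distrib mult_ac flip: power_mult)
    then show "\<forall>\<^sub>F (k, n) in sequentially \<times>\<^sub>F sequentially. norm (c k * (z * q ^ n) ^ k) \<le> norm (c k * z ^ k)"
      by (intro always_eventually) auto
  qed (use c in auto)
  moreover have "suminf ?b = c 0"
    using suminf_finite[of "{0}" ?b] by simp
  ultimately show ?thesis by simp
qed

text \<open>The series satisfies \<open>g (y * q) = (1 - y) * g y\<close>. Iterating pushes the
  argument to 0, where the value is 1, and collects the factors of
  \<open>qpoch_inf z q\<close>.\<close>

lemma has_sum_euler_inverse:
  assumes q: "norm q < 1" and z: "norm z < 1"
  shows "((\<lambda>n. z ^ n / qpoch q q n) has_sum 1 / qpoch_inf z q) UNIV"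
proof -
  obtain K where K: "K > 0" "\<And>n. norm (1 / qpoch q q n) \<le> K"
    using inverse_qpoch_bounded[OF q q] by blast
  have summ: "summable (\<lambda>n. norm (1 / qpoch q q n * y ^ n))" if "norm y < 1" for y
  proof (rule summable_comparison_test_ev)
    show "summable (\<lambda>n. K * norm y ^ n)"
      using that by (intro summable_mult summable_geometric) auto
    have "norm (1 / qpoch q q n * y ^ n) \<le> K * norm y ^ n" for n
      unfolding norm_mult norm_power by (intro mult_right_mono K) auto
    then show "\<forall>\<^sub>F n in sequentially. norm (norm (1 / qpoch q q n * y ^ n)) \<le> K * norm y ^ n"
      by simp
  qed
  define g where "g y = (\<Sum>n. 1 / qpoch q q n * y ^ n)" for y
  have zq: "norm (z * q ^ n) < 1" for n
    using mult_left_mono[OF power_le_one[of "norm q" n], of "norm z"] q z by (simp add: norm_mult norm_power)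
  have step: "g (y * q) = (1 - y) * g y" if y: "norm y < 1" for y
  proof -
    have yq: "norm (y * q) < 1"
      using mult_left_mono[of "norm q" 1 "norm y"] q y by (simp add: norm_mult)
    have s: "summable (\<lambda>n. 1 / qpoch q q n * y ^ n)" "summable (\<lambda>n. 1 / qpoch q q n * (y * q) ^ n)"
      using summ[OF y] summ[OF yq] by (blast intro: summable_norm_cancel)+
    have nz: "1 - q * q ^ n \<noteq> 0" for n
      by (rule one_minus_mult_power_nonzero[OF q q])
    have "g y - g (y * q) = (\<Sum>n. 1 / qpoch q q n * y ^ n - 1 / qpoch q q n * (y * q) ^ n)"
      unfolding g_def by (rule suminf_diff[OF s])
    also have "\<dots> = (\<Sum>n. 1 / qpoch q q (Suc n) * y ^ Suc n - 1 / qpoch q q (Suc n) * (y * q) ^ Suc n)"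
      by (subst suminf_split_head[OF summable_diff[OF s]]) simp
    also have "\<dots> = (\<Sum>n. y * (1 / qpoch q q n * y ^ n))"
      by (rule suminf_cong) (use nz qpoch_nonzero[OF q q] in \<open>simp add: qpoch_Suc divide_simps power_mult_distrib, simp add: algebra_simps\<close>)
    also have "\<dots> = y * g y"
      unfolding g_def by (rule suminf_mult[OF s(1)])
    finally show ?thesis by (simp add: algebra_simps)
  qed
  have iter: "g (z * q ^ n) = qpoch z q n * g z" for n
  proof (induction n)
    case (Suc n)
    have "g (z * q ^ Suc n) = (1 - z * q ^ n) * g (z * q ^ n)"
      using step[OF zq[of n]] by (simp add: mult_ac)
    then show ?case using Suc by (simp add: qpoch_Suc mult_ac)
  qed simp
  have "(\<lambda>n. qpoch z q n * g z) \<longlonglongrightarrow> 1 / qpoch q q 0"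
    unfolding iter[symmetric] unfolding g_def by (rule suminf_tendsto_at_powers[OF q summ[OF z]])
  moreover have "(\<lambda>n. qpoch z q n * g z) \<longlonglongrightarrow> qpoch_inf z q * g z"
    by (intro tendsto_intros qpoch_tendsto q)
  ultimately have "qpoch_inf z q * g z = 1"
    using LIMSEQ_unique by fastforce
  then have "g z = 1 / qpoch_inf z q"
    using qpoch_inf_nonzero[OF z q] by (simp add: field_simps)
  then have "(\<lambda>n. 1 / qpoch q q n * z ^ n) sums (1 / qpoch_inf z q)"
    using summable_norm_cancel[OF summ[OF z]] unfolding g_def by (simp add: sums_iff)
  from norm_summable_imp_has_sum[OF summ[OF z] this] show ?thesis
    by simp
qed

lemma triangle_Suc: "Suc n * (Suc n - 1) div 2 = n * (n - 1) div 2 + n"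
proof -
  have "Suc n * (Suc n - 1) = n * 2 + n * (n - 1)"
    by (cases n) auto
  then show ?thesis
    by (metis add.commute div_mult_self1 zero_neq_numeral)
qed

text \<open>Consecutive terms have ratio \<open>x ^ n * y\<close>, which tends to 0 however large
  \<open>y\<close> is.\<close>

lemma summable_power_triangle:
  fixes x y :: real
  assumes "0 \<le> x" "x < 1" "0 \<le> y"
  shows "summable (\<lambda>n. x ^ (n * (n - 1) div 2) * y ^ n)"
proof -
  have "(\<lambda>n. x ^ n * y) \<longlonglongrightarrow> 0 * y"
    using assms by (intro tendsto_intros LIMSEQ_power_zero) auto
  then have "\<forall>\<^sub>F n in sequentially. x ^ n * y < 1 / 2"
    by (rule order_tendstoD) auto
  then obtain N where N: "\<And>n. n \<ge> N \<Longrightarrow> x ^ n * y < 1 / 2"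
    by (auto simp: eventually_sequentially)
  show ?thesis
  proof (rule summable_ratio_test[of "1/2" N])
    fix n assume "n \<ge> N"
    have "norm (x ^ (Suc n * (Suc n - 1) div 2) * y ^ Suc n) = (x ^ n * y) * (x ^ (n * (n - 1) div 2) * y ^ n)"
      unfolding triangle_Suc using assms by (simp add: power_add abs_mult)
    also have "\<dots> \<le> 1 / 2 * (x ^ (n * (n - 1) div 2) * y ^ n)"
      using N[OF \<open>n \<ge> N\<close>] assms by (intro mult_right_mono) auto
    finally show "norm (x ^ (Suc n * (Suc n - 1) div 2) * y ^ Suc n) \<le> 1 / 2 * norm (x ^ (n * (n - 1) div 2) * y ^ n)"
      using assms by simp
  qed simp
qed

text \<open>Same scheme with the equation reversed, \<open>g y = (1 - y) * g (y * q)\<close>. The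
  triangular exponent makes the series entire, so it can be used at both z and q / z for any nonzero
  z in the triple product.\<close>

lemma has_sum_euler:
  assumes q: "norm q < 1"
  shows "((\<lambda>n. (-1) ^ n * q ^ (n * (n - 1) div 2) * z ^ n / qpoch q q n) has_sum qpoch_inf z q) UNIV"
proof -
  define c where "c n = (-1) ^ n * q ^ (n * (n - 1) div 2) / qpoch q q n" for n
  obtain K where K: "K > 0" "\<And>n. norm (1 / qpoch q q n) \<le> K"
    using inverse_qpoch_bounded[OF q q] by blast
  have summ: "summable (\<lambda>n. norm (c n * y ^ n))" for y
  proof (rule summable_comparison_test_ev)
    show "summable (\<lambda>n. K * (norm q ^ (n * (n - 1) div 2) * norm y ^ n))"
      using q by (intro summable_mult summable_power_triangle) auto
    have "norm (c n * y ^ n) \<le> K * (norm q ^ (n * (n - 1) div 2) * norm y ^ n)" for n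
    proof -
      have "norm (c n * y ^ n) = norm (1 / qpoch q q n) * (norm q ^ (n * (n - 1) div 2) * norm y ^ n)"
        by (simp add: c_def norm_mult norm_divide norm_power)
      also have "\<dots> \<le> K * (norm q ^ (n * (n - 1) div 2) * norm y ^ n)"
        by (intro mult_right_mono K) auto
      finally show ?thesis .
    qed
    then show "\<forall>\<^sub>F n in sequentially. norm (norm (c n * y ^ n)) \<le> K * (norm q ^ (n * (n - 1) div 2) * norm y ^ n)"
      by simp
  qed
  define g where "g y = (\<Sum>n. c n * y ^ n)" for y
  have s: "summable (\<lambda>n. c n * y ^ n)" for y
    using summ by (rule summable_norm_cancel)
  have step: "g y = (1 - y) * g (y * q)" for y
  proof -
    have cS: "c (Suc n) * (1 - q * q ^ n) = - (c n * q ^ n)" for n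
      using one_minus_mult_power_nonzero[OF q q, of n] qpoch_nonzero[OF q q, of n]
      unfolding c_def triangle_Suc qpoch_Suc by (simp add: power_add divide_simps)
    have "g y - g (y * q) = (\<Sum>n. c n * y ^ n - c n * (y * q) ^ n)"
      unfolding g_def by (rule suminf_diff[OF s s])
    also have "\<dots> = (\<Sum>n. c (Suc n) * y ^ Suc n - c (Suc n) * (y * q) ^ Suc n)"
      by (subst suminf_split_head[OF summable_diff[OF s s]]) simp
    also have "\<dots> = (\<Sum>n. - y * (c n * (y * q) ^ n))"
    proof (rule suminf_cong)
      fix n
      have "c (Suc n) * y ^ Suc n - c (Suc n) * (y * q) ^ Suc n = c (Suc n) * (1 - q * q ^ n) * y ^ Suc n"
        by (simp add: algebra_simps power_mult_distrib)
      then show "c (Suc n) * y ^ Suc n - c (Suc n) * (y * q) ^ Suc n = - y * (c n * (y * q) ^ n)"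
        unfolding cS by (simp add: power_mult_distrib)
    qed
    also have "\<dots> = - y * g (y * q)"
      unfolding g_def by (rule suminf_mult[OF s])
    finally show ?thesis by (simp add: algebra_simps)
  qed
  have iter: "g z = qpoch z q n * g (z * q ^ n)" for n
  proof (induction n)
    case (Suc n)
    then show ?case using step[of "z * q ^ n"] by (simp add: qpoch_Suc mult_ac)
  qed simp
  have "(\<lambda>n. g (z * q ^ n)) \<longlonglongrightarrow> c 0"
    unfolding g_def by (rule suminf_tendsto_at_powers[OF q summ])
  then have "(\<lambda>n. qpoch z q n * g (z * q ^ n)) \<longlonglongrightarrow> qpoch_inf z q * c 0"
    by (intro tendsto_intros qpoch_tendsto q)
  then have "g z = qpoch_inf z q"
    unfolding iter[symmetric] by (simp add: c_def LIMSEQ_const_iff)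
  then have "(\<lambda>n. c n * z ^ n) sums qpoch_inf z q"
    using s[of z] unfolding g_def by (simp add: sums_iff)
  from norm_summable_imp_has_sum[OF summ this] show ?thesis
    by (simp add: c_def)
qed

subsection \<open>Durfee rectangles and the Jacobi triple product\<close>

lemma has_sum_int_iff_nat:
  fixes f :: "int \<Rightarrow> complex"
  assumes "\<And>k. k < 0 \<Longrightarrow> f k = 0"
  shows "(f has_sum S) UNIV \<longleftrightarrow> ((\<lambda>n. f (int n)) has_sum S) UNIV"
proof -
  have "(f has_sum S) UNIV \<longleftrightarrow> (f has_sum S) {0..}"
    by (rule has_sum_cong_neutral) (use assms in auto)
  also have "\<dots> \<longleftrightarrow> ((\<lambda>n. f (int n)) has_sum S) UNIV"
    by (rule has_sum_reindex_bij_witness[of _ int nat]) auto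
  finally show ?thesis .
qed

lemma has_sum_UNIV_bij:
  assumes "(f has_sum S) UNIV" "\<And>a. i (j a) = a" "\<And>b. j (i b) = b" "\<And>b. f (i b) = h b"
  shows "(h has_sum S) UNIV"
proof -
  have "(f has_sum S) UNIV \<longleftrightarrow> (h has_sum S) UNIV"
    by (rule has_sum_reindex_bij_witness[of _ i j]) (use assms(2-4) in \<open>auto simp flip: assms(4)\<close>)
  then show ?thesis using assms(1) by blast
qed

text \<open>Let \<open>D N\<close> be the sum. Then \<open>D N - D (N + 1) = - q ^ (N + 1) * (D (N + 1) - D (N + 2))\<close>, and since \<open>D\<close> is
  bounded it is constant; its limit is the claimed value.\<close>

lemma durfee_rectangle:
  assumes q: "norm q < 1"
  shows "((\<lambda>m. q ^ (m * m + m * N) / (qpoch q q m * qpoch q q (m + N))) has_sum 1 / qpoch_inf q q) UNIV"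
proof -
  obtain K where K: "K > 0" "\<And>n. norm (1 / qpoch q q n) \<le> K"
    using inverse_qpoch_bounded[OF q q] by blast
  \<comment> \<open>Exponent and denominator get separate parameters because the recurrence for
    \<open>D\<close> passes through the mixed sum of \<open>t N (N + 1)\<close>.\<close>
  define t where "t N M m = q ^ (m * m + m * N) / (qpoch q q m * qpoch q q (m + M))" for N M m
  have bound: "norm (t N M m) \<le> K * K * norm q ^ m" for N M m
  proof -
    have "norm (t N M m) = norm (1 / qpoch q q m) * norm (1 / qpoch q q (m + M)) * norm q ^ (m * m + m * N)"
      by (simp add: t_def norm_mult norm_divide norm_power)
    also have "\<dots> \<le> K * K * norm q ^ m"
    proof (intro mult_mono K power_decreasing)
      show "m \<le> m * m + m * N" by (cases m) auto
    qed (use q K in auto)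
    finally show ?thesis .
  qed
  have sg: "summable (\<lambda>m. K * K * norm q ^ m)"
    using q by (intro summable_mult summable_geometric) auto
  have summ: "summable (\<lambda>m. norm (t N M m))" for N M
    by (rule summable_comparison_test_ev[OF _ sg]) (use bound in auto)
  have s: "summable (t N M)" for N M
    using summ by (rule summable_norm_cancel)
  have nz: "qpoch q q n \<noteq> 0" "1 - q * q ^ n \<noteq> 0" for n
    using qpoch_nonzero[OF q q] one_minus_mult_power_nonzero[OF q q] by auto
  define D where "D N = suminf (t N N)" for N
  have D1: "D N = suminf (t N (N + 1)) - q ^ (N + 1) * D (N + 1)" for N
  proof -
    \<comment> \<open>Expand the fraction by 1 - q^(m + N + 1); the second part of this factor
      raises N by one in the exponent.\<close>
    have "t N N m = t N (N + 1) m - q ^ (N + 1) * t (N + 1) (N + 1) m" for m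
      using nz[of "m + N"] nz[of m] unfolding t_def
      by (simp add: qpoch_Suc divide_simps, simp add: algebra_simps power_add)
    then have "D N = (\<Sum>m. t N (N + 1) m - q ^ (N + 1) * t (N + 1) (N + 1) m)"
      unfolding D_def by presburger
    also have "\<dots> = suminf (t N (N + 1)) - q ^ (N + 1) * D (N + 1)"
      unfolding D_def by (simp only: suminf_diff[OF s summable_mult[OF s], symmetric] suminf_mult[OF s])
    finally show ?thesis .
  qed
  \<comment> \<open>Here the difference of the terms carries 1 - q^m, which kills m = 0 and cancels
    the last factor of \<open>qpoch q q m\<close>; shifting m gives the sum for N + 2.\<close>
  have D2: "suminf (t N (N + 1)) - D (N + 1) = q ^ (N + 1) * D (N + 2)" for N
  proof -
    have "suminf (t N (N + 1)) - D (N + 1) = (\<Sum>m. t N (N + 1) m - t (N + 1) (N + 1) m)"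
      unfolding D_def by (rule suminf_diff[OF s s])
    also have "\<dots> = (\<Sum>m. t N (N + 1) (Suc m) - t (N + 1) (N + 1) (Suc m))"
      by (subst suminf_split_head[OF summable_diff[OF s s]]) (simp add: t_def)
    also have "\<dots> = (\<Sum>m. q ^ (N + 1) * t (N + 2) (N + 2) m)"
    proof (rule suminf_cong)
      fix m
      show "t N (N + 1) (Suc m) - t (N + 1) (N + 1) (Suc m) = q ^ (N + 1) * t (N + 2) (N + 2) m"
        using nz[of "Suc (Suc (m + N))"] nz[of m] unfolding t_def
        by (simp add: qpoch_Suc[of _ _ m] divide_simps, simp add: algebra_simps power_add)
    qed
    also have "\<dots> = q ^ (N + 1) * D (N + 2)"
      unfolding D_def by (rule suminf_mult[OF s])
    finally show ?thesis .
  qed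
  define C where "C = (\<Sum>m. K * K * norm q ^ m)"
  have DC: "norm (D N) \<le> C" for N
    unfolding D_def C_def by (rule norm_suminf_le[OF bound sg])
  have step: "D N - D (N + 1) = - (q ^ (N + 1) * (D (N + 1) - D (N + 2)))" for N
    using D1[of N] D2[of N] by (simp add: algebra_simps)
  have dec: "norm (D N - D (N + 1)) \<le> norm q ^ k * (2 * C)" for N k
  proof (induction k arbitrary: N)
    case 0
    show ?case using DC[of N] DC[of "N + 1"] norm_triangle_ineq4[of "D N" "D (N + 1)"] by simp
  next
    case (Suc k)
    have "norm (D N - D (N + 1)) = norm q ^ (N + 1) * norm (D (N + 1) - D (N + 1 + 1))"
      unfolding step[of N] by (simp add: norm_mult norm_power)
    also have "\<dots> \<le> norm q ^ 1 * (norm q ^ k * (2 * C))"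
      by (intro mult_mono power_decreasing Suc) (use q in auto)
    finally show ?case by (simp add: mult_ac)
  qed
  have "D N = D (N + 1)" for N
  proof -
    have "(\<lambda>k. norm q ^ k * (2 * C)) \<longlonglongrightarrow> 0 * (2 * C)"
      using q by (intro tendsto_intros LIMSEQ_power_zero) auto
    then have "norm (D N - D (N + 1)) \<le> 0"
      using dec by (intro LIMSEQ_le_const) auto
    then show ?thesis by simp
  qed
  then have const: "D N = D 0" for N
    by (induction N) auto
  \<comment> \<open>As N grows, q^(m N) removes every term with m > 0, and the term m = 0 tends to
    the asserted value.\<close>
  let ?b = "\<lambda>m. if m = 0 then 1 / qpoch_inf q q else 0"
  have "(\<lambda>N. suminf (\<lambda>m. t N N m)) \<longlonglongrightarrow> suminf ?b"
  proof (rule tannerys_theorem[where M = "\<lambda>m. K * K * norm q ^ m", THEN conjunct2, THEN conjunct2])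
    show "(\<lambda>N. t N N m) \<longlonglongrightarrow> ?b m" for m
    proof -
      have *: "(\<lambda>N. qpoch q q (m + N)) \<longlonglongrightarrow> qpoch_inf q q"
        using LIMSEQ_ignore_initial_segment[OF qpoch_tendsto[OF q], of q m] by (simp add: add.commute)
      have **: "(\<lambda>N. (q ^ m) ^ N) \<longlonglongrightarrow> (if m = 0 then 1 else 0)"
      proof (cases "m = 0")
        case False
        then have "norm (q ^ m) < 1"
          using q by (simp add: norm_power power_less_one_iff)
        then show ?thesis using False by (simp add: LIMSEQ_power_zero)
      qed simp
      have "(\<lambda>N. q ^ (m * m) * (q ^ m) ^ N / (qpoch q q m * qpoch q q (m + N)))
          \<longlonglongrightarrow> q ^ (m * m) * (if m = 0 then 1 else 0) / (qpoch q q m * qpoch_inf q q)"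
        using nz qpoch_inf_nonzero[OF q q] by (intro tendsto_intros * **) auto
      then show ?thesis
        by (cases "m = 0") (simp_all add: t_def power_add power_mult)
    qed
    show "\<forall>\<^sub>F (m, N) in sequentially \<times>\<^sub>F sequentially. norm (t N N m) \<le> K * K * norm q ^ m"
      using bound by (intro always_eventually) auto
  qed (use sg in auto)
  moreover have "suminf ?b = 1 / qpoch_inf q q"
    using suminf_finite[of "{0}" ?b] by simp
  moreover have "(\<lambda>N. suminf (\<lambda>m. t N N m)) = (\<lambda>N. D 0)"
    using const unfolding D_def by auto
  ultimately have "D 0 = 1 / qpoch_inf q q"
    by (simp add: LIMSEQ_const_iff)
  then have "t N N sums (1 / qpoch_inf q q)"
    using const[of N] s unfolding D_def by (simp add: sums_iff)
  from norm_summable_imp_has_sum[OF summ this] show ?thesis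
    unfolding t_def .
qed

text \<open>The usual convention 1 / (q; q)_k = 0 for negative k. It turns one-sided and finite sums
  into sums over all integers, which can be shifted and reflected freely.\<close>

definition qpoch_recip :: "complex \<Rightarrow> int \<Rightarrow> complex" where
  "qpoch_recip q k = (if k < 0 then 0 else 1 / qpoch q q (nat k))"

lemma qpoch_recip_of_nat [simp]: "qpoch_recip q (int n) = 1 / qpoch q q n"
  and qpoch_recip_neg: "k < 0 \<Longrightarrow> qpoch_recip q k = 0"
  by (simp_all add: qpoch_recip_def)

text \<open>At k = 0 the factor \<open>1 - q powi 0\<close> vanishes, in agreement with the zero
  convention, so one recurrence serves all integers.\<close>

lemma qpoch_recip_minus_one:
  assumes q: "norm q < 1"
  shows "qpoch_recip q (k - 1) = (1 - q powi k) * qpoch_recip q k"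
proof (cases "k > 0")
  case True
  then obtain n where n: "k = int (Suc n)"
    by (metis gr0_implies_Suc pos_int_cases)
  have "q powi k = q * q ^ n" "qpoch_recip q k = 1 / qpoch q q (Suc n)"
    unfolding n qpoch_recip_of_nat power_int_of_nat by simp_all
  moreover have "k - 1 = int n" using n by simp
  ultimately show ?thesis
    using one_minus_mult_power_nonzero[OF q q, of n] qpoch_nonzero[OF q q]
    by (simp add: qpoch_Suc)
qed (auto simp: qpoch_recip_def)

text \<open>Shifting k by c exchanges the two reciprocals and turns c into -c, which reduces
  negative c to the natural case.\<close>

lemma durfee_rectangle_int:
  assumes q: "norm q < 1" "q \<noteq> 0"
  shows "((\<lambda>k. q powi (k * k + k * c) * qpoch_recip q k * qpoch_recip q (k + c)) has_sum 1 / qpoch_inf q q) UNIV"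
proof -
  have nonneg: "((\<lambda>k. q powi (k * k + k * int N) * qpoch_recip q k * qpoch_recip q (k + int N)) has_sum 1 / qpoch_inf q q) UNIV" for N
  proof (subst has_sum_int_iff_nat)
    show "((\<lambda>n. q powi (int n * int n + int n * int N) * qpoch_recip q (int n) * qpoch_recip q (int n + int N)) has_sum
        1 / qpoch_inf q q) UNIV"
      using durfee_rectangle[OF q(1), of N] by (simp flip: of_nat_mult of_nat_add)
  qed (simp add: qpoch_recip_neg)
  show ?thesis
  proof (cases "c \<ge> 0")
    case True
    then show ?thesis using nonneg[of "nat c"] by simp
  next
    case False
    show ?thesis
    proof (rule has_sum_UNIV_bij[OF nonneg[of "nat (-c)"]])
      show "q powi ((k + c) * (k + c) + (k + c) * int (nat (- c))) * qpoch_recip q (k + c) * qpoch_recip q (k + c + int (nat (- c)))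
        = q powi (k * k + k * c) * qpoch_recip q k * qpoch_recip q (k + c)" for k
        using False by (simp add: algebra_simps)
      show "k - c + c = k" "k + c - c = k" for k by auto
    qed
  qed
qed

text \<open>Identities between exponents with n (n - 1) / 2 are checked after doubling, which
  removes the integer division; \<open>double_int_eqD\<close> undoes the doubling.\<close>

lemma two_triangle: "2 * (n * (n - 1) div 2) = n * (n - 1)" for n :: int
  by simp

lemma double_int_eqD: "2 * a = 2 * b \<Longrightarrow> a = b" for a b :: int
  by simp

lemma has_sum_euler_int:
  assumes q: "norm q < 1" and z: "z \<noteq> 0"
  shows "((\<lambda>n. (-z) powi n * q powi (n * (n - 1) div 2) * qpoch_recip q n) has_sum qpoch_inf z q) UNIV"
proof (subst has_sum_int_iff_nat)
  have "(-z) powi int n * q powi (int n * (int n - 1) div 2) * qpoch_recip q (int n)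
      = (-1) ^ n * q ^ (n * (n - 1) div 2) * z ^ n / qpoch q q n" for n
  proof -
    have "int n * (int n - 1) div 2 = int (n * (n - 1) div 2)"
      by (cases n) (simp_all add: zdiv_int algebra_simps)
    then show ?thesis
      by (simp add: power_minus[of z] del: of_nat_mult of_nat_diff)
  qed
  then show "((\<lambda>n. (-z) powi int n * q powi (int n * (int n - 1) div 2) * qpoch_recip q (int n)) has_sum qpoch_inf z q) UNIV"
    using has_sum_euler[OF q, of z] by presburger
qed (simp add: qpoch_recip_neg)

text \<open>The coefficient of \<open>z powi n\<close> in the product of the two Euler series is a Durfee rectangle sum.\<close>

lemma jacobi_triple_product:
  assumes q: "norm q < 1" "q \<noteq> 0" and z: "z \<noteq> 0"
  shows "((\<lambda>n. (-z) powi n * q powi (n * (n - 1) div 2)) has_sum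
           qpoch_inf z q * qpoch_inf (q / z) q * qpoch_inf q q) UNIV"
proof -
  let ?P = "qpoch_inf z q * qpoch_inf (q / z) q"
  have prod: "((\<lambda>(a, b). ((-z) powi a * q powi (a * (a - 1) div 2) * qpoch_recip q a)
        * ((-(q / z)) powi b * q powi (b * (b - 1) div 2) * qpoch_recip q b)) has_sum ?P) UNIV"
    unfolding UNIV_Times_UNIV[symmetric] by (intro has_sum_times has_sum_euler_int) (use q z in auto)
  have "((\<lambda>(n, k). (-z) powi n * q powi (n * (n - 1) div 2)
        * (q powi (k * k + k * n) * qpoch_recip q k * qpoch_recip q (k + n))) has_sum ?P) UNIV"
  proof (rule has_sum_UNIV_bij[OF prod, where i = "\<lambda>(n, k). (k + n, k)" and j = "\<lambda>(a, b). (a - b, b)"], goal_cases)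
    case (3 x)
    obtain n b where x: "x = (n, b)" by (cases x)
    define a where "a = b + n"
    have n: "n = a - b" by (simp add: a_def)
    have e: "(a - b) * (a - b - 1) div 2 + (b * b + b * (a - b)) = a * (a - 1) div 2 + b * (b - 1) div 2 + b"
    proof -
      have "2 * ((a - b) * (a - b - 1) div 2 + (b * b + b * (a - b))) = 2 * (a * (a - 1) div 2 + b * (b - 1) div 2 + b)"
        unfolding distrib_left[of 2] two_triangle by (simp add: algebra_simps)
      then show ?thesis by (rule double_int_eqD)
    qed
    \<comment> \<open>The product of z and q / z is q, so collapsing the z-powers leaves
      \<open>q powi b\<close>; this is the last summand of the exponent identity
      \<open>e\<close>.\<close>
    have "(-z) powi a = (-z) powi (a - b) * (-z) powi b"
      using z by (simp flip: power_int_add)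
    moreover have "(-z) powi b * (-(q / z)) powi b = q powi b"
      using z by (simp flip: power_int_mult_distrib)
    ultimately have 1: "(-z) powi a * (-(q / z)) powi b = (-z) powi (a - b) * q powi b"
      by simp
    have 2: "q powi ((a - b) * (a - b - 1) div 2) * q powi (b * b + b * (a - b))
        = q powi (a * (a - 1) div 2) * q powi (b * (b - 1) div 2) * q powi b"
      using e q by (simp flip: power_int_add)
    have ring: "A * X * R1 * (B * Y * R2) = C * D * (E * R2 * R1)" if "A * B = C * F" "D * E = X * Y * F"
      for A B C D E F X Y R1 R2 :: complex
    proof -
      have "A * X * R1 * (B * Y * R2) = (A * B) * X * Y * R1 * R2" by simp
      also have "\<dots> = C * (X * Y * F) * R1 * R2" unfolding that(1) by simp
      finally show ?thesis unfolding that(2)[symmetric] by simp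
    qed
    show ?case
      unfolding x prod.case n using ring[OF 1 2, of "qpoch_recip q a" "qpoch_recip q b"] by simp
  qed auto
  then have "((\<lambda>(n, k). (-z) powi n * q powi (n * (n - 1) div 2)
        * (q powi (k * k + k * n) * qpoch_recip q k * qpoch_recip q (k + n))) has_sum ?P) (UNIV \<times> UNIV)"
    by simp
  then have "((\<lambda>n. (-z) powi n * q powi (n * (n - 1) div 2) * (1 / qpoch_inf q q)) has_sum ?P) UNIV"
    by (rule has_sum_SigmaD) (use has_sum_cmult_right[OF durfee_rectangle_int[OF q]] in auto)
  from has_sum_cmult_left[OF this, of "qpoch_inf q q"] show ?thesis
    using qpoch_inf_nonzero[OF q(1) q(1)] by simp
qed

text \<open>The triple product at s p^c in base p^N; since 1 / s = s, the complementary argument is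
  s p^(N - c). The sign s = 1 yields \<open>theta7\<close>, and s = -1 yields the sign-free series
  of \<open>theta_plus\<close>.\<close>

lemma theta_has_sum:
  fixes p s :: complex
  assumes p: "norm p < 1" "p \<noteq> 0" and s: "s * s = 1" and c: "c \<le> N" "N > 0"
  shows "((\<lambda>n. (-s) powi n * p powi (int N * (n * (n - 1) div 2) + int c * n)) has_sum
    qpoch_inf (s * p ^ c) (p ^ N) * qpoch_inf (s * p ^ (N - c)) (p ^ N) * qpoch_inf (p ^ N) (p ^ N)) UNIV"
proof -
  have s0: "s \<noteq> 0" using s by auto
  have "p ^ N / (s * p ^ c) = s * s * (p ^ N / (s * p ^ c))" using s by simp
  also have "\<dots> = s * p ^ (N - c)" using s0 p c by (simp add: power_diff)
  finally have d: "p ^ N / (s * p ^ c) = s * p ^ (N - c)" .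
  have "norm (p ^ N) < 1" using p c by (simp add: norm_power power_less_one_iff)
  from jacobi_triple_product[OF this, of "s * p ^ c"] s0 p
  have "((\<lambda>n. (- (s * p ^ c)) powi n * (p ^ N) powi (n * (n - 1) div 2)) has_sum
    qpoch_inf (s * p ^ c) (p ^ N) * qpoch_inf (s * p ^ (N - c)) (p ^ N) * qpoch_inf (p ^ N) (p ^ N)) UNIV"
    unfolding d by simp
  moreover have "(- (s * p ^ c)) powi n * (p ^ N) powi (n * (n - 1) div 2) =
      (-s) powi n * p powi (int N * (n * (n - 1) div 2) + int c * n)" for n
  proof -
    have "(- (s * p ^ c)) powi n = (-s) powi n * p powi (int c * n)"
      by (simp only: power_int_mult power_int_of_nat mult_minus_left[symmetric] power_int_mult_distrib)
    moreover have "(p ^ N) powi (n * (n - 1) div 2) = p powi (int N * (n * (n - 1) div 2))"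
      by (simp only: power_int_mult power_int_of_nat)
    ultimately show ?thesis using p by (simp add: power_int_add)
  qed
  ultimately show ?thesis by simp
qed

text \<open>With s = -1 all signs disappear, and the convergence already contained in the triple
  product is absolute.\<close>

lemma theta_norm_summable:
  fixes p :: complex
  assumes p: "norm p < 1" "p \<noteq> 0" and c: "c \<le> N" "N > 0"
  shows "(\<lambda>n. norm (p powi (int N * (n * (n - 1) div 2) + int c * n))) summable_on UNIV"
proof -
  have "(\<lambda>n. p powi (int N * (n * (n - 1) div 2) + int c * n)) summable_on UNIV"
    using has_sum_imp_summable[OF theta_has_sum[OF p, of "-1" c N]] c by simp
  then show ?thesis
    by (simp add: summable_on_iff_abs_summable_on_complex)
qed

subsection \<open>Bailey's lemma and the Rogers--Selberg identities\<close>

text \<open>The beta-side of a Bailey pair with a bilateral weight: a = b corresponds to Bailey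
  parameter 1, and b = a + 1 to parameter q up to the factor 1 - q. Keeping \<open>a\<close> and
  \<open>b\<close> apart lets recurrences lower one of them at a time.\<close>

definition bailey_sum :: "complex \<Rightarrow> (int \<Rightarrow> complex) \<Rightarrow> int \<Rightarrow> int \<Rightarrow> complex" where
  "bailey_sum q w a b = (\<Sum>\<^sub>\<infinity>r. w r * qpoch_recip q (a - r) * qpoch_recip q (b + r))"

lemma bailey_sum_summable:
  "(\<lambda>r. w r * qpoch_recip q (a - r) * qpoch_recip q (b + r)) summable_on UNIV"
proof (rule finite_nonzero_values_imp_summable_on)
  have "{r \<in> UNIV. w r * qpoch_recip q (a - r) * qpoch_recip q (b + r) \<noteq> 0} \<subseteq> {-b..a}"
    by (auto simp: qpoch_recip_def split: if_splits)
  then show "finite {r \<in> UNIV. w r * qpoch_recip q (a - r) * qpoch_recip q (b + r) \<noteq> 0}"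
    by (rule finite_subset) simp
qed

lemma bailey_sum_has_sum:
  "((\<lambda>r. w r * qpoch_recip q (a - r) * qpoch_recip q (b + r)) has_sum bailey_sum q w a b) UNIV"
  unfolding bailey_sum_def by (rule has_sum_infsum[OF bailey_sum_summable])

lemma bailey_sum_shift: "bailey_sum q w a b = bailey_sum q (\<lambda>r. w (r + c)) (a - c) (b + c)"
  unfolding bailey_sum_def
  by (rule infsum_reindex_bij_witness[of _ "\<lambda>r. r + c" "\<lambda>r. r - c"]) (auto simp: algebra_simps)

lemma bailey_sum_reflect: "bailey_sum q w a b = bailey_sum q (\<lambda>r. w (c - r)) (b + c) (a - c)"
  unfolding bailey_sum_def
  by (rule infsum_reindex_bij_witness[of _ "\<lambda>r. c - r" "\<lambda>r. c - r"]) (auto simp: algebra_simps)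

lemma bailey_sum_cmult: "bailey_sum q (\<lambda>r. x * w r) a b = x * bailey_sum q w a b"
  unfolding bailey_sum_def mult.assoc by (rule infsum_cmult_right')

text \<open>For a = b + c the reflection r -> c - r swaps the two reciprocals, so the sum is its own
  negative. This removes the twisted term in \<open>bailey_sum_step_A\<close> and
  \<open>bailey_sum_C\<close>.\<close>

lemma bailey_sum_antisymmetric:
  assumes "\<And>r. w (c - r) = - w r" "a = b + c"
  shows "bailey_sum q w a b = 0"
proof -
  have "bailey_sum q w a b = bailey_sum q (\<lambda>r. -1 * w r) a b"
    using bailey_sum_reflect[of q w a b c] assms by simp
  also have "\<dots> = - bailey_sum q w a b"
    unfolding bailey_sum_cmult by simp
  finally show ?thesis by simp
qed

lemma bailey_sum_neg:
  assumes "a + b < 0"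
  shows "bailey_sum q w a b = 0"
proof -
  have "w r * qpoch_recip q (a - r) * qpoch_recip q (b + r) = 0" for r
    using assms by (auto simp: qpoch_recip_def)
  then show ?thesis unfolding bailey_sum_def by (simp only: infsum_0_simp)
qed

lemma bailey_sum_0: "bailey_sum q w 0 0 = w 0"
proof -
  have "w r * qpoch_recip q (0 - r) * qpoch_recip q (0 + r) = (if r = 0 then w 0 else 0)" for r
    by (auto simp: qpoch_recip_def)
  then show ?thesis unfolding bailey_sum_def
    by (intro infsumI has_sum_finite_neutralI[of "{0}"]) (auto simp: qpoch_recip_def)
qed

context
  fixes q :: complex
  assumes q: "norm q < 1" "q \<noteq> 0"
begin

text \<open>Lowering a produces the factor 1 - q^(a - r) by \<open>qpoch_recip_minus_one\<close>;
  its q^(-r) is absorbed into the weight.\<close>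

lemma bailey_sum_lower_left:
  "bailey_sum q w (a - 1) b = bailey_sum q w a b - q powi a * bailey_sum q (\<lambda>r. w r * q powi (-r)) a b"
proof -
  let ?f = "\<lambda>w r. w r * qpoch_recip q (a - r) * qpoch_recip q (b + r)"
  have "((\<lambda>r. ?f w r + (- (q powi a)) * ?f (\<lambda>r. w r * q powi (-r)) r) has_sum
      bailey_sum q w a b + (- (q powi a)) * bailey_sum q (\<lambda>r. w r * q powi (-r)) a b) UNIV"
    by (intro has_sum_add has_sum_cmult_right bailey_sum_has_sum)
  moreover have "?f w r + (- (q powi a)) * ?f (\<lambda>r. w r * q powi (-r)) r
      = w r * qpoch_recip q (a - 1 - r) * qpoch_recip q (b + r)" for r
  proof -
    have *: "a - 1 - r = a - r - 1" by simp
    have e: "qpoch_recip q (a - 1 - r) = (1 - q powi a * q powi (-r)) * qpoch_recip q (a - r)"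
      unfolding * qpoch_recip_minus_one[OF q(1)] using q by (simp flip: power_int_add)
    show ?thesis unfolding e by (simp add: algebra_simps)
  qed
  ultimately have "((\<lambda>r. w r * qpoch_recip q (a - 1 - r) * qpoch_recip q (b + r)) has_sum
      bailey_sum q w a b + (- (q powi a)) * bailey_sum q (\<lambda>r. w r * q powi (-r)) a b) UNIV"
    by (simp only:)
  then show ?thesis
    using has_sum_unique[OF bailey_sum_has_sum[of w q "a - 1" b]] by simp
qed

lemma bailey_sum_lower_right:
  "bailey_sum q w a (b - 1) = bailey_sum q w a b - q powi b * bailey_sum q (\<lambda>r. w r * q powi r) a b"
  using bailey_sum_lower_left[of "\<lambda>r. w (- r)" b a]
  by (simp add: bailey_sum_reflect[of q _ a "b - 1" 0] bailey_sum_reflect[of q _ a b 0])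

text \<open>The two \<open>q\<close>-Pascal rules, with the \<open>q\<close>-binomial coefficients divided by \<open>(q; q)\<^bsub>a + b\<^esub>\<close>.\<close>

lemma bailey_sum_pascal_left:
  "(1 - q powi (a + b)) * bailey_sum q w a b =
    bailey_sum q w (a - 1) b + q powi a * bailey_sum q (\<lambda>r. w r * q powi (-r)) a (b - 1)"
proof -
  \<comment> \<open>Lowering on the opposite side untwists the weight, so the original sum reappears
    with factor q^(a + b).\<close>
  have "bailey_sum q (\<lambda>r. w r * q powi (-r) * q powi r) a b = bailey_sum q w a b"
    using q by (simp add: mult.assoc flip: power_int_add)
  then show ?thesis
    unfolding bailey_sum_lower_left[of w a b] bailey_sum_lower_right[of "\<lambda>r. w r * q powi (-r)" a b]
    using q by (simp add: power_int_add algebra_simps)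
qed

lemma bailey_sum_pascal_right:
  "(1 - q powi (a + b)) * bailey_sum q w a b =
    bailey_sum q w a (b - 1) + q powi b * bailey_sum q (\<lambda>r. w r * q powi r) (a - 1) b"
proof -
  have "bailey_sum q (\<lambda>r. w r * q powi r * q powi (-r)) a b = bailey_sum q w a b"
    using q by (simp add: mult.assoc flip: power_int_add)
  then show ?thesis
    unfolding bailey_sum_lower_right[of w a b] bailey_sum_lower_left[of "\<lambda>r. w r * q powi r" a b]
    using q by (simp add: power_int_add algebra_simps)
qed

text \<open>Summing over n before r leaves, after the shift n -> n + r, a Durfee sum with excess 2 r
  + d, whose value does not depend on r. This is the limit of Bailey's lemma in which both free
  parameters go to infinity.\<close>

lemma bailey_lemma:
  assumes w: "(\<lambda>r. norm (w r)) summable_on UNIV" and d: "d \<le> 1"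
    and T: "((\<lambda>r. w r * q powi (r * r + int d * r)) has_sum T) UNIV"
  shows "((\<lambda>n. q powi (n * n + int d * n) * bailey_sum q w n (n + int d)) has_sum T / qpoch_inf q q) UNIV"
proof -
  obtain K where K: "K > 0" "\<And>n. norm (1 / qpoch q q n) \<le> K"
    using inverse_qpoch_bounded[OF q(1) q(1)] by blast
  have KR: "norm (qpoch_recip q k) \<le> K" for k
    using K by (auto simp: qpoch_recip_def)
  define f where "f = (\<lambda>(n, r). q powi (n * n + int d * n) * (w r * qpoch_recip q (n - r) * qpoch_recip q (n + int d + r)))"
  \<comment> \<open>The majorant in n is a theta series in base q^2 with shift 1 + d;
    \<open>d \<le> 1\<close> keeps this shift within the range of
    \<open>theta_norm_summable\<close>.\<close>
  have eq: "int 2 * (n * (n - 1) div 2) + int (1 + d) * n = n * n + int d * n" for n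
    using two_triangle[of n] by (simp add: algebra_simps)
  have summ_q: "(\<lambda>n. norm (q powi (n * n + int d * n))) summable_on UNIV"
    using theta_norm_summable[OF q, of "1 + d" 2] d unfolding eq by simp
  have "f summable_on UNIV \<times> UNIV"
  proof (rule summable_on_times_bound)
    show "(\<lambda>n. norm (q powi (n * n + int d * n)) * (K * K)) summable_on UNIV"
      by (rule summable_on_cmult_left[OF summ_q])
    show "norm (f (n, r)) \<le> norm (q powi (n * n + int d * n)) * (K * K) * norm (w r)" for n r
    proof -
      have "norm (f (n, r)) = norm (q powi (n * n + int d * n)) * (norm (qpoch_recip q (n - r)) * norm (qpoch_recip q (n + int d + r))) * norm (w r)"
        by (simp add: f_def norm_mult)
      also have "\<dots> \<le> norm (q powi (n * n + int d * n)) * (K * K) * norm (w r)"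
        by (intro mult_mono KR order_refl mult_nonneg_nonneg) (use K in auto)
      finally show ?thesis .
    qed
  qed (use w K in auto)
  then obtain V where V: "(f has_sum V) (UNIV \<times> UNIV)"
    by (auto simp: summable_on_def)
  have rows: "((\<lambda>n. q powi (n * n + int d * n) * bailey_sum q w n (n + int d)) has_sum V) UNIV"
    by (rule has_sum_SigmaD[OF V]) (use has_sum_cmult_right[OF bailey_sum_has_sum] in \<open>auto simp: f_def\<close>)
  have col: "((\<lambda>n. f (n, r)) has_sum w r * q powi (r * r + int d * r) * (1 / qpoch_inf q q)) UNIV" for r
  proof (rule has_sum_UNIV_bij[OF has_sum_cmult_right[OF durfee_rectangle_int[OF q, of "2 * r + int d"], of "w r * q powi (r * r + int d * r)"]])
    show "w r * q powi (r * r + int d * r) * (q powi ((n - r) * (n - r) + (n - r) * (2 * r + int d)) *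
        qpoch_recip q (n - r) * qpoch_recip q (n - r + (2 * r + int d))) = f (n, r)" for n
    proof -
      have "q powi (r * r + int d * r) * q powi ((n - r) * (n - r) + (n - r) * (2 * r + int d)) = q powi (n * n + int d * n)"
        using q by (simp add: power_int_add[symmetric] algebra_simps)
      then show ?thesis by (simp add: f_def algebra_simps)
    qed
    show "n + r - r = n" "n - r + r = n" for n by auto
  qed
  have "((\<lambda>(r, n). f (n, r)) has_sum V) UNIV"
    by (rule has_sum_UNIV_bij[where f = f and i = prod.swap and j = prod.swap]) (use V in auto)
  then have V': "((\<lambda>(r, n). f (n, r)) has_sum V) (UNIV \<times> UNIV)"
    by simp
  have "((\<lambda>r. w r * q powi (r * r + int d * r) * (1 / qpoch_inf q q)) has_sum V) UNIV"
    by (rule has_sum_SigmaD[OF V']) (use col in auto)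
  moreover have "((\<lambda>r. w r * q powi (r * r + int d * r) * (1 / qpoch_inf q q)) has_sum T * (1 / qpoch_inf q q)) UNIV"
    by (rule has_sum_cmult_left[OF T])
  ultimately have "V = T * (1 / qpoch_inf q q)"
    by (rule has_sum_unique)
  then show ?thesis using rows by simp
qed

end

section \<open>Bailey pairs in base p^2 with weights in p\<close>

lemma minus_one_powi: "(-1 :: complex) powi n = (if even n then 1 else -1)"
  by (simp add: power_int_minus_left)

text \<open>The exponent is \<open>r (3 r - 1) / 2\<close>, written so that it visibly is an integer.\<close>

definition rs_weight :: "complex \<Rightarrow> int \<Rightarrow> complex" where
  "rs_weight p r = (-1) powi r * p powi (3 * (r * (r - 1) div 2) + r)"

definition theta7 :: "complex \<Rightarrow> nat \<Rightarrow> complex" where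
  "theta7 p c = qpoch_inf (p ^ c) (p ^ 7) * qpoch_inf (p ^ (7 - c)) (p ^ 7) * qpoch_inf (p ^ 7) (p ^ 7)"

context
  fixes p :: complex
  assumes p: "norm p < 1" "p \<noteq> 0"
begin

lemma norm_p2: "norm (p ^ 2) < 1" "p ^ 2 \<noteq> 0"
  using p by (simp_all add: norm_power power_less_one_iff)

lemma p2_powi: "(p ^ 2) powi k = p powi (2 * k)"
  by (simp add: power_int_mult)

text \<open>The twist by q^r changes the exponent to 3 r (r + 1) / 2, symmetric under r -> -1 - r,
  while the sign (-1)^r flips.\<close>

lemma rs_weight_antisymmetric:
  "rs_weight p (-1 - r) * (p ^ 2) powi (-1 - r) = - (rs_weight p r * (p ^ 2) powi r)"
proof -
  have "3 * ((-1 - r) * (-1 - r - 1) div 2) + (-1 - r) + 2 * (-1 - r) = 3 * (r * (r - 1) div 2) + r + 2 * r"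
  proof (rule double_int_eqD)
    have "2 * (3 * ((-1 - r) * (-1 - r - 1) div 2) + (-1 - r) + 2 * (-1 - r))
        = 3 * (2 * ((-1 - r) * (-1 - r - 1) div 2)) + 6 * (-1 - r)" by simp
    also have "\<dots> = 3 * (2 * (r * (r - 1) div 2)) + 6 * r"
      unfolding two_triangle by (simp add: algebra_simps)
    finally show "2 * (3 * ((-1 - r) * (-1 - r - 1) div 2) + (-1 - r) + 2 * (-1 - r)) = 2 * (3 * (r * (r - 1) div 2) + r + 2 * r)"
      by simp
  qed
  then have "p powi (3 * ((-1 - r) * (-1 - r - 1) div 2) + (-1 - r)) * p powi (2 * (-1 - r)) =
      p powi (3 * (r * (r - 1) div 2) + r) * p powi (2 * r)"
    using p by (simp only: power_int_add[symmetric] simp_thms)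
  moreover have "(-1 :: complex) powi (-1 - r) = - ((-1) powi r)"
    by (simp add: minus_one_powi)
  ultimately show ?thesis
    unfolding rs_weight_def p2_powi by simp
qed

text \<open>The exponent r (3 r - 1) / 2 - 2 r, taken at r + 1, is r (3 r + 1) / 2 - 1: the opposite
  twist only shifts and reflects the weight and costs -1 / p.\<close>

lemma rs_weight_shift: "rs_weight p (r + 1) * (p ^ 2) powi (- (r + 1)) = - inverse p * rs_weight p (- r)"
proof -
  have "3 * ((r + 1) * (r + 1 - 1) div 2) + (r + 1) + 2 * (- (r + 1)) = -1 + (3 * ((- r) * (- r - 1) div 2) + (- r))"
  proof (rule double_int_eqD)
    have "2 * (3 * ((r + 1) * (r + 1 - 1) div 2) + (r + 1) + 2 * (- (r + 1)))
        = 3 * (2 * ((r + 1) * (r + 1 - 1) div 2)) - 2 * (r + 1)" by simp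
    also have "\<dots> = - 2 + (3 * (2 * ((- r) * (- r - 1) div 2)) - 2 * r)"
      unfolding two_triangle by (simp add: algebra_simps)
    finally show "2 * (3 * ((r + 1) * (r + 1 - 1) div 2) + (r + 1) + 2 * (- (r + 1))) = 2 * (-1 + (3 * ((- r) * (- r - 1) div 2) + (- r)))"
      by simp
  qed
  then have "p powi (3 * ((r + 1) * (r + 1 - 1) div 2) + (r + 1)) * p powi (2 * (- (r + 1))) =
      p powi (-1) * p powi (3 * ((- r) * (- r - 1) div 2) + (- r))"
    using p by (simp only: power_int_add[symmetric] simp_thms)
  moreover have "(-1 :: complex) powi (r + 1) = - ((-1) powi (- r))"
    by (simp add: minus_one_powi)
  ultimately show ?thesis
    unfolding rs_weight_def p2_powi by (simp add: power_int_minus)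
qed

text \<open>In the right Pascal rule the twisted sum vanishes by antisymmetry about r = -1/2. With
  \<open>bailey_sum_step_B\<close> this gives a ladder (n, n), (n + 1, n), (n + 1, n + 1) with one
  explicit factor per rung.\<close>

lemma bailey_sum_step_A:
  "(1 - (p ^ 2) powi (2 * n)) * bailey_sum (p ^ 2) (rs_weight p) n n = bailey_sum (p ^ 2) (rs_weight p) n (n - 1)"
proof -
  have "bailey_sum (p ^ 2) (\<lambda>r. rs_weight p r * (p ^ 2) powi r) (n - 1) n = 0"
    by (rule bailey_sum_antisymmetric[where c = "-1" and w = "\<lambda>r. rs_weight p r * (p ^ 2) powi r", OF rs_weight_antisymmetric]) simp
  then show ?thesis
    using bailey_sum_pascal_right[OF norm_p2, of n n "rs_weight p"] by simp
qed

text \<open>In the left Pascal rule a shift by 1 and a reflection return the twisted sum to (n, n).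
  The numerator factor arises from q^(n + 1) / p = p q^n, where q is p^2.\<close>

lemma bailey_sum_step_B:
  "(1 - (p ^ 2) powi (2 * n + 1)) * bailey_sum (p ^ 2) (rs_weight p) (n + 1) n
    = (1 - p * (p ^ 2) powi n) * bailey_sum (p ^ 2) (rs_weight p) n n"
proof -
  have "bailey_sum (p ^ 2) (\<lambda>r. rs_weight p r * (p ^ 2) powi (- r)) (n + 1) (n - 1)
      = bailey_sum (p ^ 2) (\<lambda>r. - inverse p * rs_weight p (- r)) n n"
    using bailey_sum_shift[of "p ^ 2" "\<lambda>r. rs_weight p r * (p ^ 2) powi (- r)" "n + 1" "n - 1" 1]
    unfolding rs_weight_shift by simp
  also have "\<dots> = - inverse p * bailey_sum (p ^ 2) (rs_weight p) n n"
    using bailey_sum_reflect[of "p ^ 2" "rs_weight p" n n 0] unfolding bailey_sum_cmult by simp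
  finally have "(1 - (p ^ 2) powi (2 * n + 1)) * bailey_sum (p ^ 2) (rs_weight p) (n + 1) n
      = bailey_sum (p ^ 2) (rs_weight p) n n + (p ^ 2) powi (n + 1) * (- inverse p * bailey_sum (p ^ 2) (rs_weight p) n n)"
    using bailey_sum_pascal_left[OF norm_p2, of "n + 1" n "rs_weight p"] by (simp add: algebra_simps)
  moreover have "(p ^ 2) powi (n + 1) * (- inverse p * x) = - p * (p ^ 2) powi n * x" for x
    using p by (simp add: power_int_add power2_eq_square)
  ultimately show ?thesis
    by (simp only:) (simp add: algebra_simps)
qed

text \<open>Antisymmetry makes the lowering term zero, so one sequence of values serves both d = 0
  and d = 1 in \<open>rogers_selberg\<close>.\<close>

lemma bailey_sum_C:
  "bailey_sum (p ^ 2) (rs_weight p) n (n + 1) = bailey_sum (p ^ 2) (rs_weight p) n n"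
proof -
  have "bailey_sum (p ^ 2) (\<lambda>r. rs_weight p r * (p ^ 2) powi r) n (n + 1) = 0"
    by (rule bailey_sum_antisymmetric[where c = "-1" and w = "\<lambda>r. rs_weight p r * (p ^ 2) powi r", OF rs_weight_antisymmetric]) simp
  then show ?thesis
    using bailey_sum_lower_right[OF norm_p2, of "rs_weight p" n "n + 1"] by simp
qed

text \<open>Climbing the ladder from the value 1 at (0, 0). In classical form the values are 1 /
  ((p^2; p^2)_n (-p; p)_{2 n}) and 1 / ((p^2; p^2)_n (-p; p)_{2 n + 1}).\<close>

lemma bailey_pair:
  "bailey_sum (p ^ 2) (rs_weight p) (int n) (int n) = qpoch p (p ^ 2) n / qpoch (p ^ 2) (p ^ 2) (2 * n) \<and>
   bailey_sum (p ^ 2) (rs_weight p) (int n + 1) (int n) = qpoch p (p ^ 2) (n + 1) / qpoch (p ^ 2) (p ^ 2) (2 * n + 1)"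
proof -
  note nz = qpoch_nonzero[OF norm_p2(1) norm_p2(1)] one_minus_mult_power_nonzero[OF norm_p2(1) norm_p2(1)]
  have B: "bailey_sum (p ^ 2) (rs_weight p) (int n + 1) (int n) = qpoch p (p ^ 2) (n + 1) / qpoch (p ^ 2) (p ^ 2) (2 * n + 1)"
    if A: "bailey_sum (p ^ 2) (rs_weight p) (int n) (int n) = qpoch p (p ^ 2) n / qpoch (p ^ 2) (p ^ 2) (2 * n)" for n
  proof -
    have e: "(p ^ 2) powi (2 * int n + 1) = p ^ 2 * (p ^ 2) ^ (2 * n)"
      using power_int_of_nat[of "p ^ 2" "2 * n + 1"] by (simp add: add.commute)
    show ?thesis
      using bailey_sum_step_B[of "int n"] nz[of "2 * n"] unfolding e A power_int_of_nat
      by (simp add: qpoch_Suc divide_simps mult_ac)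
  qed
  have A: "bailey_sum (p ^ 2) (rs_weight p) (int n) (int n) = qpoch p (p ^ 2) n / qpoch (p ^ 2) (p ^ 2) (2 * n)"
  proof (induction n)
    case 0
    show ?case by (simp add: bailey_sum_0 rs_weight_def)
  next
    case (Suc n)
    have e: "(p ^ 2) powi (2 * (int n + 1)) = p ^ 2 * (p ^ 2) ^ (2 * n + 1)"
      using power_int_of_nat[of "p ^ 2" "2 * n + 2"] by (simp add: add.commute algebra_simps)
    have "bailey_sum (p ^ 2) (rs_weight p) (int n + 1) (int n + 1) = qpoch p (p ^ 2) (n + 1) / qpoch (p ^ 2) (p ^ 2) (Suc (2 * n + 1))"
      using bailey_sum_step_A[of "int n + 1"] nz[of "2 * n + 1"] unfolding e qpoch_Suc[of _ _ "2 * n + 1"]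
      by (simp add: B[OF Suc] divide_simps mult_ac)
    then show ?case by (simp add: add.commute)
  qed
  then show ?thesis using B by blast
qed

lemma rs_weight_norm_summable: "(\<lambda>r. norm (rs_weight p r)) summable_on UNIV"
  using theta_norm_summable[OF p, of 1 3] by (simp add: rs_weight_def norm_mult norm_power_int)

lemma bailey_sum_rogers_selberg:
  assumes w: "(\<lambda>r. norm (w r)) summable_on UNIV" and d: "d \<le> 1" and c: "c \<le> 7"
    and e: "\<And>r. w r * (p ^ 2) powi (r * r + int d * r) = (-1) powi r * p powi (int 7 * (r * (r - 1) div 2) + int c * r)"
    and b: "\<And>n. bailey_sum (p ^ 2) w (int n) (int n + int d) = \<beta> n"
  shows "((\<lambda>n. (p ^ 2) ^ (n\<^sup>2 + d * n) * \<beta> n) has_sum theta7 p c / qpoch_inf (p ^ 2) (p ^ 2)) UNIV"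
proof -
  have "((\<lambda>r. w r * (p ^ 2) powi (r * r + int d * r)) has_sum theta7 p c) UNIV"
    unfolding e theta7_def using theta_has_sum[OF p, of 1 c 7] c by simp
  \<comment> \<open>For negative n the two indices add up to 2 n + d, at most -1, so
    \<open>bailey_sum_neg\<close> makes the sum one-sided.\<close>
  from bailey_lemma[OF norm_p2 w d this]
  have "((\<lambda>n. (p ^ 2) powi (int n * int n + int d * int n) * bailey_sum (p ^ 2) w (int n) (int n + int d)) has_sum
      theta7 p c / qpoch_inf (p ^ 2) (p ^ 2)) UNIV"
    by (subst (asm) has_sum_int_iff_nat) (use d in \<open>auto simp: bailey_sum_neg\<close>)
  moreover have "(p ^ 2) powi (int n * int n + int d * int n) = (p ^ 2) ^ (n\<^sup>2 + d * n)" for n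
    by (simp only: power2_eq_square[of n] flip: power_int_of_nat of_nat_mult of_nat_add)
  ultimately show ?thesis unfolding b by simp
qed

lemma rs_exponent: 
  assumes "d \<le> 1"
  shows "rs_weight p r * (p ^ 2) powi (r * r + int d * r) = (-1) powi r * p powi (int 7 * (r * (r - 1) div 2) + int (3 + 2 * d) * r)"
proof -
  have "3 * (r * (r - 1) div 2) + r + 2 * (r * r + int d * r) = int 7 * (r * (r - 1) div 2) + int (3 + 2 * d) * r"
  proof -
    define t where "t = r * (r - 1) div 2"
    have "2 * t = r * (r - 1)" unfolding t_def by (rule two_triangle)
    then show ?thesis unfolding t_def[symmetric] by (simp add: algebra_simps)
  qed
  then have "p powi (3 * (r * (r - 1) div 2) + r) * p powi (2 * (r * r + int d * r)) = p powi (int 7 * (r * (r - 1) div 2) + int (3 + 2 * d) * r)"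
    using p by (simp only: power_int_add[symmetric] simp_thms)
  then show ?thesis
    unfolding rs_weight_def p2_powi by simp
qed

lemma rs_exponent':
  "rs_weight p (- r) * (p ^ 2) powi (r * r + int 1 * r) = (-1) powi r * p powi (int 7 * (r * (r - 1) div 2) + int 6 * r)"
proof -
  have "3 * ((- r) * (- r - 1) div 2) + (- r) + 2 * (r * r + int 1 * r) = int 7 * (r * (r - 1) div 2) + int 6 * r"
  proof -
    define t u where "t = r * (r - 1) div 2" and "u = (- r) * (- r - 1) div 2"
    have "2 * t = r * (r - 1)" "2 * u = (- r) * (- r - 1)" unfolding t_def u_def by (rule two_triangle)+
    then show ?thesis unfolding t_def[symmetric] u_def[symmetric] by (simp add: algebra_simps)
  qed
  then have "p powi (3 * ((- r) * (- r - 1) div 2) + (- r)) * p powi (2 * (r * r + int 1 * r)) = p powi (int 7 * (r * (r - 1) div 2) + int 6 * r)"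
    using p by (simp only: power_int_add[symmetric] simp_thms)
  moreover have "(-1 :: complex) powi (- r) = (-1) powi r"
    by (simp add: minus_one_powi)
  ultimately show ?thesis
    unfolding rs_weight_def p2_powi by simp
qed

lemma rogers_selberg:
  assumes d: "d \<le> 1"
  shows "((\<lambda>n. (p ^ 2) ^ (n\<^sup>2 + d * n) * (qpoch p (p ^ 2) n / qpoch (p ^ 2) (p ^ 2) (2 * n))) has_sum
    theta7 p (3 + 2 * d) / qpoch_inf (p ^ 2) (p ^ 2)) UNIV"
proof (rule bailey_sum_rogers_selberg[OF rs_weight_norm_summable d _ rs_exponent[OF d]])
  show "bailey_sum (p ^ 2) (rs_weight p) (int n) (int n + int d) = qpoch p (p ^ 2) n / qpoch (p ^ 2) (p ^ 2) (2 * n)" for n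
    using d bailey_pair bailey_sum_C by (cases d) auto
qed (use d in simp)

text \<open>The second values of \<open>bailey_pair\<close> sit at (n + 1, n); reflecting the weight
  moves them to (n, n + 1), the shape for d = 1, and changes the linear exponent to give c =
  6.\<close>

lemma rogers_selberg':
  "((\<lambda>n. (p ^ 2) ^ (n\<^sup>2 + 1 * n) * (qpoch p (p ^ 2) (n + 1) / qpoch (p ^ 2) (p ^ 2) (2 * n + 1))) has_sum
    theta7 p 6 / qpoch_inf (p ^ 2) (p ^ 2)) UNIV"
proof (rule bailey_sum_rogers_selberg[where w = "\<lambda>r. rs_weight p (- r)", OF _ _ _ rs_exponent'])
  show "(\<lambda>r. norm (rs_weight p (- r))) summable_on UNIV"
    using rs_weight_norm_summable summable_on_reindex_bij_witness[of UNIV uminus uminus UNIV "\<lambda>r. norm (rs_weight p (- r))" "\<lambda>r. norm (rs_weight p r)"]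
    by simp
  show "bailey_sum (p ^ 2) (\<lambda>r. rs_weight p (- r)) (int n) (int n + int 1)
      = qpoch p (p ^ 2) (n + 1) / qpoch (p ^ 2) (p ^ 2) (2 * n + 1)" for n
    using bailey_pair[of n] bailey_sum_reflect[of "p ^ 2" "\<lambda>r. rs_weight p (- r)" "int n" "int n + 1" 0] by simp
qed auto

end

subsection \<open>Double sums as even and odd parts\<close>

lemma qpoch_add: "qpoch a q (m + n) = qpoch a q m * qpoch (a * q ^ m) q n"
  by (induction n) (simp_all add: qpoch_Suc power_add mult_ac)

lemma qpoch_inf_split:
  assumes "norm q < 1"
  shows "qpoch_inf a q = qpoch a q n * qpoch_inf (a * q ^ n) q"
proof (rule LIMSEQ_unique)
  show "(\<lambda>k. qpoch a q (k + n)) \<longlonglongrightarrow> qpoch_inf a q"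
    by (rule LIMSEQ_ignore_initial_segment[OF qpoch_tendsto[OF assms]])
  show "(\<lambda>k. qpoch a q (k + n)) \<longlonglongrightarrow> qpoch a q n * qpoch_inf (a * q ^ n) q"
    unfolding add.commute[of _ n] qpoch_add by (intro tendsto_intros qpoch_tendsto assms)
qed

lemma qpoch_inf_dissect:
  assumes q: "norm q < 1" and m: "m > 0"
  shows "qpoch_inf a q = (\<Prod>r<m. qpoch_inf (a * q ^ r) (q ^ m))"
proof (rule LIMSEQ_unique)
  show "(\<lambda>n. qpoch a q (m * n)) \<longlonglongrightarrow> qpoch_inf a q"
    using LIMSEQ_subseq_LIMSEQ[OF qpoch_tendsto[OF q], of "\<lambda>n. m * n" a] m by (simp add: strict_mono_def o_def)
  have fin: "qpoch a q (m * n) = (\<Prod>r<m. qpoch (a * q ^ r) (q ^ m) n)" for n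
  proof (induction n)
    case (Suc n)
    have "qpoch a q (m * Suc n) = qpoch a q (m * n) * qpoch (a * q ^ (m * n)) q m"
      using qpoch_add[of a q "m * n" m] by (simp add: add.commute)
    also have "\<dots> = (\<Prod>r<m. qpoch (a * q ^ r) (q ^ m) n * (1 - a * q ^ r * (q ^ m) ^ n))"
      unfolding Suc qpoch_def[of _ _ m] prod.distrib by (simp add: power_mult mult_ac)
    finally show ?case by (simp add: qpoch_Suc)
  qed simp
  have "norm (q ^ m) < 1" using q m by (simp add: norm_power power_less_one_iff)
  then show "(\<lambda>n. qpoch a q (m * n)) \<longlonglongrightarrow> (\<Prod>r<m. qpoch_inf (a * q ^ r) (q ^ m))"
    unfolding fin by (intro tendsto_prod qpoch_tendsto)
qed

lemma qpoch_inf_mult_minus: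
  assumes "norm q < 1"
  shows "qpoch_inf a q * qpoch_inf (- a) q = qpoch_inf (a ^ 2) (q ^ 2)"
proof (rule LIMSEQ_unique)
  have fin: "qpoch a q n * qpoch (- a) q n = qpoch (a ^ 2) (q ^ 2) n" for n
    unfolding qpoch_def prod.distrib[symmetric]
    by (rule prod.cong) (simp_all add: algebra_simps power2_eq_square power_mult_distrib)
  show "(\<lambda>n. qpoch a q n * qpoch (- a) q n) \<longlonglongrightarrow> qpoch_inf a q * qpoch_inf (- a) q"
    by (intro tendsto_intros qpoch_tendsto assms)
  show "(\<lambda>n. qpoch a q n * qpoch (- a) q n) \<longlonglongrightarrow> qpoch_inf (a ^ 2) (q ^ 2)"
    unfolding fin using assms by (intro qpoch_tendsto) (simp add: norm_power power_less_one_iff)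
qed

text \<open>Expands each reciprocal product and upgrades the iterated sum to an unconditional one
  over pairs. The uniform radius \<rho> and the decay of \<open>u\<close> make the majorant
  geometric in both variables.\<close>

lemma euler_double_sum:
  assumes q: "norm q < 1" and \<rho>: "0 \<le> \<rho>" "\<rho> < 1" and z: "\<And>i. norm (z i) \<le> \<rho>"
    and u: "\<And>i. norm (u i) \<le> M * norm q ^ i"
    and S: "((\<lambda>i. u i * (1 / qpoch_inf (z i) q)) has_sum S) UNIV"
  shows "((\<lambda>(i, m). u i * (z i ^ m / qpoch q q m)) has_sum S) (UNIV :: (nat \<times> nat) set)"
proof -
  obtain K where K: "K > 0" "\<And>n. norm (1 / qpoch q q n) \<le> K"
    using inverse_qpoch_bounded[OF q q] by blast
  have M: "M \<ge> 0" using order_trans[OF norm_ge_zero u[of 0]] by simp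
  have "((\<lambda>(i, m). u i * (z i ^ m / qpoch q q m)) has_sum S) (UNIV \<times> UNIV)"
  proof (rule has_sum_SigmaI[OF _ S])
    show "((\<lambda>m. case (i, m) of (i, m) \<Rightarrow> u i * (z i ^ m / qpoch q q m)) has_sum u i * (1 / qpoch_inf (z i) q)) UNIV" for i
      using has_sum_cmult_right[OF has_sum_euler_inverse[OF q, of "z i"], of "u i"] z[of i] \<rho> by simp
    show "(\<lambda>(i, m). u i * (z i ^ m / qpoch q q m)) summable_on UNIV \<times> UNIV"
    proof (rule summable_on_times_bound)
      show "(\<lambda>i. M * norm q ^ i) summable_on UNIV"
        using q by (intro summable_on_cmult_right norm_summable_imp_summable_on) (simp add: summable_geometric)
      show "(\<lambda>m. K * \<rho> ^ m) summable_on UNIV"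
        using \<rho> by (intro summable_on_cmult_right norm_summable_imp_summable_on) (simp add: summable_geometric)
      show "norm (case (i, m) of (i, m) \<Rightarrow> u i * (z i ^ m / qpoch q q m)) \<le> (M * norm q ^ i) * (K * \<rho> ^ m)" for i m
      proof -
        have "norm (case (i, m) of (i, m) \<Rightarrow> u i * (z i ^ m / qpoch q q m)) = norm (u i) * (norm (1 / qpoch q q m) * norm (z i) ^ m)"
          by (simp add: norm_mult norm_divide norm_power)
        also have "\<dots> \<le> (M * norm q ^ i) * (K * \<rho> ^ m)"
          by (intro mult_mono u K power_mono z mult_nonneg_nonneg) (use K \<rho> M in auto)
        finally show ?thesis .
      qed
    qed (use K M \<rho> in auto)
  qed
  then show ?thesis by simp
qed

text \<open>Half the sum of the two series keeps the even m, and half their difference divided by p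
  keeps the odd m. Only the values at p and -p enter; coefficients in p are never compared.\<close>

lemma parity_split:
  fixes u y :: "nat \<Rightarrow> complex"
  assumes p: "p \<noteq> 0"
    and plus: "((\<lambda>(i, m). u i * ((p * y i) ^ m / qpoch q q m)) has_sum E + p * D) (UNIV :: (nat \<times> nat) set)"
    and minus: "((\<lambda>(i, m). u i * ((- p * y i) ^ m / qpoch q q m)) has_sum E - p * D) (UNIV :: (nat \<times> nat) set)"
  shows "((\<lambda>(i, j). u i * ((p * y i) ^ (2 * j) / qpoch q q (2 * j))) has_sum E) (UNIV :: (nat \<times> nat) set)"
    and "((\<lambda>(i, j). u i * (p ^ (2 * j) * y i ^ (2 * j + 1) / qpoch q q (2 * j + 1))) has_sum D) (UNIV :: (nat \<times> nat) set)"
proof -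
  let ?f = "\<lambda>(i, m). u i * ((p * y i) ^ m / qpoch q q m)"
  have m: "u i * ((- p * y i) ^ m / qpoch q q m) = (-1) ^ m * ?f (i, m)" for i m
    by (simp add: power_minus[of "p * y i"])
  let ?g = "\<lambda>(i, m). u i * ((- p * y i) ^ m / qpoch q q m)"
  have "((\<lambda>x. 1 / 2 * ?f x + 1 / 2 * ?g x) has_sum (1 / 2 * (E + p * D) + 1 / 2 * (E - p * D))) UNIV"
    by (intro has_sum_cmult_right has_sum_add plus minus)
  moreover have "1 / 2 * (E + p * D) + 1 / 2 * (E - p * D) = E"
    by (simp add: field_simps)
  ultimately have "((\<lambda>x. 1 / 2 * ?f x + 1 / 2 * ?g x) has_sum E) UNIV"
    by simp
  then have "(?f has_sum E) {(i, m). even m}"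
    by (rule has_sum_cong_neutral[THEN iffD1, rotated -1]) (auto simp: m)
  then show "((\<lambda>(i, j). u i * ((p * y i) ^ (2 * j) / qpoch q q (2 * j))) has_sum E) (UNIV :: (nat \<times> nat) set)"
    by (rule has_sum_reindex_bij_witness[where j = "\<lambda>(i, m). (i, m div 2)" and i = "\<lambda>(i, m). (i, 2 * m)", THEN iffD1, rotated -1])
       auto
  have "((\<lambda>x. 1 / (2 * p) * ?f x + - (1 / (2 * p)) * ?g x) has_sum (1 / (2 * p) * (E + p * D) + - (1 / (2 * p)) * (E - p * D))) UNIV"
    by (intro has_sum_cmult_right has_sum_add plus minus)
  moreover have "1 / (2 * p) * (E + p * D) + - (1 / (2 * p)) * (E - p * D) = D"
    using p by (simp add: field_simps)
  ultimately have "((\<lambda>x. 1 / (2 * p) * ?f x + - (1 / (2 * p)) * ?g x) has_sum D) UNIV"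
    by simp
  then have "((\<lambda>x. 1 / p * ?f x) has_sum D) {(i, m). odd m}"
    by (rule has_sum_cong_neutral[THEN iffD1, rotated -1]) (use p in \<open>auto simp: m\<close>)
  then show "((\<lambda>(i, j). u i * (p ^ (2 * j) * y i ^ (2 * j + 1) / qpoch q q (2 * j + 1))) has_sum D) (UNIV :: (nat \<times> nat) set)"
    by (rule has_sum_reindex_bij_witness[where j = "\<lambda>(i, m). (i, m div 2)" and i = "\<lambda>(i, m). (i, 2 * m + 1)", THEN iffD1, rotated -1])
       (use p in \<open>auto simp: power_mult_distrib elim!: oddE\<close>)
qed

section \<open>Products of two theta functions\<close>

definition theta_plus :: "complex \<Rightarrow> nat \<Rightarrow> nat \<Rightarrow> complex" where
  "theta_plus p N c = qpoch_inf (- (p ^ c)) (p ^ N) * qpoch_inf (- (p ^ (N - c))) (p ^ N) * qpoch_inf (p ^ N) (p ^ N)"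

lemma theta_plus_has_sum:
  assumes "norm p < 1" "p \<noteq> 0" "c \<le> N" "N > 0"
  shows "((\<lambda>n. p powi (int N * (n * (n - 1) div 2) + int c * n)) has_sum theta_plus p N c) UNIV"
  using theta_has_sum[OF assms(1,2) _ assms(3,4), of "-1"] by (simp add: theta_plus_def)

text \<open>Split the double series according to the parity of \<open>m + n\<close> and substitute \<open>m = s + t\<close>, \<open>n = s - t\<close>,
  respectively \<open>m = s + t + 1\<close>, \<open>n = s - t\<close>.\<close>

lemma theta_plus_mult:
  assumes p: "norm p < 1" "p \<noteq> 0" and N: "N > 0" "b \<le> N" "c \<le> N" "e \<le> N" "f \<le> N" "g \<le> N" "h \<le> N"
    and eqs: "2 * e = b + c" "2 * f + c = N + b" "2 * g = N + b + c" "2 * h + c = 2 * N + b"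
  shows "theta_plus p N b * theta_plus p N c =
    theta_plus (p ^ 2) N e * theta_plus (p ^ 2) N f + p ^ b * (theta_plus (p ^ 2) N g * theta_plus (p ^ 2) N h)"
proof -
  have q: "norm (p ^ 2) < 1" "p ^ 2 \<noteq> 0"
    using p by (simp_all add: norm_power power_less_one_iff)
  define F where "F = (\<lambda>(m, n). p powi (int N * (m * (m - 1) div 2) + int b * m) * p powi (int N * (n * (n - 1) div 2) + int c * n))"
  have whole: "(F has_sum theta_plus p N b * theta_plus p N c) UNIV"
    unfolding F_def UNIV_Times_UNIV[symmetric] by (intro has_sum_times theta_plus_has_sum p N)
  define G where "G a d = (\<lambda>(s, t). (p ^ 2) powi (int N * (s * (s - 1) div 2) + int a * s) * (p ^ 2) powi (int N * (t * (t - 1) div 2) + int d * t))" for a d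
  have G: "(G a d has_sum theta_plus (p ^ 2) N a * theta_plus (p ^ 2) N d) UNIV" if "a \<le> N" "d \<le> N" for a d
    unfolding G_def UNIV_Times_UNIV[symmetric] by (intro has_sum_times theta_plus_has_sum q N that)
  \<comment> \<open>The left sides are the coefficients of s and t after the substitution, for even
    and for odd m + n. They are halved because the quadratic part doubles, which moves the base from
    p to p^2.\<close>
  have z: "int b + int c = 2 * int e" "int N + int b - int c = 2 * int f" "int N + int b + int c = 2 * int g" "2 * int N + int b - int c = 2 * int h"
    using eqs by linarith+
  have tri: "int N * (2 * (m * (m - 1) div 2)) = int N * (m * (m - 1))" for m :: int
    by (simp only: two_triangle)
  let ?A = "{(m, n). even (m + n)} :: (int \<times> int) set"
  have "(F has_sum theta_plus (p ^ 2) N e * theta_plus (p ^ 2) N f) ?A"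
  proof (rule has_sum_reindex_bij_witness[of UNIV "\<lambda>(m, n). ((m + n) div 2, (m - n) div 2)" "\<lambda>(s, t). (s + t, s - t)" ?A F "G e f", THEN iffD1])
    show "F (case x of (s, t) \<Rightarrow> (s + t, s - t)) = G e f x" for x
    proof -
      obtain s t where x: "x = (s, t)" by (cases x)
      have "(int N * ((s + t) * (s + t - 1) div 2) + int b * (s + t)) + (int N * ((s - t) * (s - t - 1) div 2) + int c * (s - t))
          = 2 * (int N * (s * (s - 1) div 2) + int e * s) + 2 * (int N * (t * (t - 1) div 2) + int f * t)" (is "?l = ?r")
      proof (rule double_int_eqD)
        have "2 * ?l = int N * ((s + t) * (s + t - 1)) + int N * ((s - t) * (s - t - 1)) + 2 * int b * (s + t) + 2 * int c * (s - t)"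
          unfolding tri[symmetric] by (simp add: algebra_simps)
        also have "\<dots> = 2 * (int N * (s * (s - 1))) + 2 * (int N * (t * (t - 1))) + 2 * (int b + int c) * s + 2 * (int N + int b - int c) * t"
          by (simp add: algebra_simps)
        also have "\<dots> = 2 * (int N * (s * (s - 1))) + 2 * (int N * (t * (t - 1))) + 2 * (2 * int e) * s + 2 * (2 * int f) * t"
          by (simp only: z)
        also have "\<dots> = 2 * ?r"
          unfolding tri[symmetric] by (simp add: algebra_simps)
        finally show "2 * ?l = 2 * ?r" .
      qed
      then show ?thesis
        unfolding x F_def G_def prod.case p2_powi[OF p] using p by (simp only: power_int_add[symmetric] simp_thms)
    qed
    show "(G e f has_sum theta_plus (p ^ 2) N e * theta_plus (p ^ 2) N f) UNIV"
      by (intro G N)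
  qed (auto, presburger+)
  moreover have "(F has_sum p ^ b * (theta_plus (p ^ 2) N g * theta_plus (p ^ 2) N h)) (- ?A)"
  proof (rule has_sum_reindex_bij_witness[of UNIV "\<lambda>(m, n). ((m + n - 1) div 2, (m - n - 1) div 2)" "\<lambda>(s, t). (s + t + 1, s - t)" "- ?A" F "\<lambda>x. p ^ b * G g h x", THEN iffD1])
    show "F (case x of (s, t) \<Rightarrow> (s + t + 1, s - t)) = p ^ b * G g h x" for x
    proof -
      obtain s t where x: "x = (s, t)" by (cases x)
      have "(int N * ((s + t + 1) * (s + t + 1 - 1) div 2) + int b * (s + t + 1)) + (int N * ((s - t) * (s - t - 1) div 2) + int c * (s - t))
          = int b + (2 * (int N * (s * (s - 1) div 2) + int g * s) + 2 * (int N * (t * (t - 1) div 2) + int h * t))" (is "?l = ?r")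
      proof (rule double_int_eqD)
        have "2 * ?l = int N * ((s + t + 1) * (s + t + 1 - 1)) + int N * ((s - t) * (s - t - 1)) + 2 * int b * (s + t + 1) + 2 * int c * (s - t)"
          unfolding tri[symmetric] by (simp add: algebra_simps)
        also have "\<dots> = 2 * int b + 2 * (int N * (s * (s - 1))) + 2 * (int N * (t * (t - 1))) + 2 * (int N + int b + int c) * s + 2 * (2 * int N + int b - int c) * t"
          by (simp add: algebra_simps)
        also have "\<dots> = 2 * int b + 2 * (int N * (s * (s - 1))) + 2 * (int N * (t * (t - 1))) + 2 * (2 * int g) * s + 2 * (2 * int h) * t"
          by (simp only: z)
        also have "\<dots> = 2 * ?r"
          unfolding tri[symmetric] by (simp add: algebra_simps)
        finally show "2 * ?l = 2 * ?r" .
      qed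
      moreover have "p ^ b = p powi int b" by simp
      ultimately show ?thesis
        unfolding x F_def G_def prod.case p2_powi[OF p] using p by (simp only: power_int_add[symmetric] simp_thms)
    qed
    show "((\<lambda>x. p ^ b * G g h x) has_sum p ^ b * (theta_plus (p ^ 2) N g * theta_plus (p ^ 2) N h)) UNIV"
      by (intro has_sum_cmult_right G N)
  qed (auto, presburger+)
  ultimately have "(F has_sum theta_plus (p ^ 2) N e * theta_plus (p ^ 2) N f + p ^ b * (theta_plus (p ^ 2) N g * theta_plus (p ^ 2) N h)) (?A \<union> - ?A)"
    by (rule has_sum_Un_disjoint) auto
  then show ?thesis
    using has_sum_unique[OF whole] by simp
qed

section \<open>Rogers--Selberg identities as unrestricted double sums\<close>

context
  fixes p :: complex
  assumes p: "norm p < 1" "p \<noteq> 0"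
begin

lemma qpoch_inf_square_base: "qpoch_inf p p = qpoch_inf p (p ^ 2) * qpoch_inf (p ^ 2) (p ^ 2)"
  using qpoch_inf_dissect[OF p(1), of 2 p] by (simp add: numeral_2_eq_2)

text \<open>The factor \<open>qpoch p (p ^ 2) (i + a)\<close> is the head of (p; p^2)_inf, so
  dividing by the whole product leaves the reciprocal tail that Euler expands. The two denominators
  merge into (p; p)_inf.\<close>

lemma rogers_selberg_double_general:
  assumes k: "\<And>i. norm (w i) \<le> K" and d: "d \<le> 1"
    and S: "((\<lambda>i. (p ^ 2) ^ (i\<^sup>2 + d * i) * (qpoch p (p ^ 2) (i + a) * w i)) has_sum T / qpoch_inf (p ^ 2) (p ^ 2)) UNIV"
  shows "((\<lambda>(i, m). (p ^ 2) ^ (i\<^sup>2 + d * i) * w i * ((p * (p ^ 2) ^ (i + a)) ^ m / qpoch (p ^ 2) (p ^ 2) m))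
    has_sum T / qpoch_inf p p) (UNIV :: (nat \<times> nat) set)"
proof (rule euler_double_sum[OF norm_p2(1)[OF p], where \<rho> = "norm p" and M = K])
  note q = norm_p2[OF p]
  show "norm (p * (p ^ 2) ^ (i + a)) \<le> norm p" for i
    using mult_left_mono[OF power_le_one[of "norm (p ^ 2)" "i + a"], of "norm p"] q
    by (simp add: norm_mult norm_power)
  show "norm ((p ^ 2) ^ (i\<^sup>2 + d * i) * w i) \<le> K * norm (p ^ 2) ^ i" for i
  proof -
    have "i \<le> i\<^sup>2 + d * i" by (cases i) (auto simp: power2_eq_square)
    then have "norm (p ^ 2) ^ (i\<^sup>2 + d * i) \<le> norm (p ^ 2) ^ i"
      using q by (intro power_decreasing) auto
    then have "norm (p ^ 2) ^ (i\<^sup>2 + d * i) * norm (w i) \<le> norm (p ^ 2) ^ i * K"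
      by (intro mult_mono k) auto
    then show ?thesis by (simp add: norm_mult norm_power mult.commute)
  qed
  have "((\<lambda>i. (p ^ 2) ^ (i\<^sup>2 + d * i) * (qpoch p (p ^ 2) (i + a) * w i) * (1 / qpoch_inf p (p ^ 2))) has_sum
      T / qpoch_inf (p ^ 2) (p ^ 2) * (1 / qpoch_inf p (p ^ 2))) UNIV"
    by (rule has_sum_cmult_left[OF S])
  moreover have "(p ^ 2) ^ (i\<^sup>2 + d * i) * (qpoch p (p ^ 2) (i + a) * w i) * (1 / qpoch_inf p (p ^ 2))
      = (p ^ 2) ^ (i\<^sup>2 + d * i) * w i * (1 / qpoch_inf (p * (p ^ 2) ^ (i + a)) (p ^ 2))" for i
    using qpoch_inf_split[OF q(1), of p "i + a"] qpoch_nonzero[OF p(1) q(1), of "i + a"] by simp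
  ultimately show "((\<lambda>i. (p ^ 2) ^ (i\<^sup>2 + d * i) * w i * (1 / qpoch_inf (p * (p ^ 2) ^ (i + a)) (p ^ 2))) has_sum T / qpoch_inf p p) UNIV"
    unfolding qpoch_inf_square_base by (simp add: mult.commute)
qed (use p in auto)

lemma rogers_selberg_double:
  assumes d: "d \<le> 1"
  shows "((\<lambda>(i, m). (p ^ 2) ^ (i\<^sup>2 + d * i) * (1 / qpoch (p ^ 2) (p ^ 2) (2 * i)) * ((p * (p ^ 2) ^ i) ^ m / qpoch (p ^ 2) (p ^ 2) m))
    has_sum theta7 p (3 + 2 * d) / qpoch_inf p p) (UNIV :: (nat \<times> nat) set)"
proof -
  obtain K where K: "K > 0" "\<And>n. norm (1 / qpoch (p ^ 2) (p ^ 2) n) \<le> K"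
    using inverse_qpoch_bounded[OF norm_p2(1)[OF p] norm_p2(1)[OF p]] by blast
  show ?thesis
    using rogers_selberg_double_general[OF K(2) d, where a = 0 and T = "theta7 p (3 + 2 * d)"] rogers_selberg[OF p d] by simp
qed

lemma rogers_selberg_double':
  "((\<lambda>(i, m). (p ^ 2) ^ (i\<^sup>2 + 1 * i) * (1 / qpoch (p ^ 2) (p ^ 2) (2 * i + 1)) * ((p * (p ^ 2) ^ (i + 1)) ^ m / qpoch (p ^ 2) (p ^ 2) m))
    has_sum theta7 p 6 / qpoch_inf p p) (UNIV :: (nat \<times> nat) set)"
proof -
  obtain K where K: "K > 0" "\<And>n. norm (1 / qpoch (p ^ 2) (p ^ 2) n) \<le> K"
    using inverse_qpoch_bounded[OF norm_p2(1)[OF p] norm_p2(1)[OF p]] by blast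
  show ?thesis
    by (rule rogers_selberg_double_general[OF K(2), where d = 1 and a = 1 and T = "theta7 p 6"])
       (use rogers_selberg'[OF p] in simp_all)
qed

end

subsection \<open>Two-dissections of the modulus 7 products\<close>

text \<open>Indexing products by modulus and residue turns the modular identities below into
  cancellation between monomials in finitely many nonzero atoms.\<close>

definition qpoch_mod :: "complex \<Rightarrow> nat \<Rightarrow> nat \<Rightarrow> complex" where
  "qpoch_mod q N r = qpoch_inf (q ^ r) (q ^ N)"

lemma qpoch_mod_nonzero:
  assumes "norm q < 1" "N > 0" "r > 0"
  shows "qpoch_mod q N r \<noteq> 0"
  unfolding qpoch_mod_def using assms by (intro qpoch_inf_nonzero) (simp_all add: norm_power power_less_one_iff)

lemma qpoch_mod_dissect:
  assumes "norm q < 1" "N > 0" "m > 0"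
  shows "qpoch_mod q N r = (\<Prod>j<m. qpoch_mod q (N * m) (r + N * j))"
proof -
  have "norm (q ^ N) < 1" using assms by (simp add: norm_power power_less_one_iff)
  from qpoch_inf_dissect[OF this assms(3), of "q ^ r"] show ?thesis
    unfolding qpoch_mod_def by (simp add: power_add power_mult)
qed

lemmas prod_numeral = lessThan_nat_numeral lessThan_Suc

lemma qpoch_inf_mod28:
  assumes "norm q < 1"
  shows "qpoch_inf q q = qpoch_mod q 28 1 * qpoch_mod q 28 2 * qpoch_mod q 28 3 * qpoch_mod q 28 4
      * qpoch_mod q 28 5 * qpoch_mod q 28 6 * qpoch_mod q 28 7 * qpoch_mod q 28 8 * qpoch_mod q 28 9
      * qpoch_mod q 28 10 * qpoch_mod q 28 11 * qpoch_mod q 28 12 * qpoch_mod q 28 13 * qpoch_mod q 28 14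
      * qpoch_mod q 28 15 * qpoch_mod q 28 16 * qpoch_mod q 28 17 * qpoch_mod q 28 18 * qpoch_mod q 28 19
      * qpoch_mod q 28 20 * qpoch_mod q 28 21 * qpoch_mod q 28 22 * qpoch_mod q 28 23 * qpoch_mod q 28 24
      * qpoch_mod q 28 25 * qpoch_mod q 28 26 * qpoch_mod q 28 27 * qpoch_mod q 28 28"
  using qpoch_mod_dissect[OF assms, of 1 28 1] by (simp add: prod_numeral qpoch_mod_def[of q "Suc 0"] mult_ac flip: numeral_2_eq_2)

lemma qpoch_inf_odd_mod28:
  assumes "norm q < 1"
  shows "qpoch_inf q (q ^ 2) = qpoch_mod q 28 1 * qpoch_mod q 28 3 * qpoch_mod q 28 5 * qpoch_mod q 28 7
      * qpoch_mod q 28 9 * qpoch_mod q 28 11 * qpoch_mod q 28 13 * qpoch_mod q 28 15 * qpoch_mod q 28 17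
      * qpoch_mod q 28 19 * qpoch_mod q 28 21 * qpoch_mod q 28 23 * qpoch_mod q 28 25 * qpoch_mod q 28 27"
  using qpoch_mod_dissect[OF assms, of 2 14 1] by (simp add: prod_numeral qpoch_mod_def[of q 2] mult_ac)

lemma qpoch_inf_mod14:
  assumes "norm q < 1"
  shows "qpoch_inf q q = qpoch_mod q 14 1 * qpoch_mod q 14 2 * qpoch_mod q 14 3 * qpoch_mod q 14 4
      * qpoch_mod q 14 5 * qpoch_mod q 14 6 * qpoch_mod q 14 7 * qpoch_mod q 14 8 * qpoch_mod q 14 9
      * qpoch_mod q 14 10 * qpoch_mod q 14 11 * qpoch_mod q 14 12 * qpoch_mod q 14 13 * qpoch_mod q 14 14"
  using qpoch_mod_dissect[OF assms, of 1 14 1] by (simp add: prod_numeral qpoch_mod_def[of q "Suc 0"] mult_ac flip: numeral_2_eq_2)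

lemma qpoch_mod_7_14:
  assumes "norm q < 1"
  shows "qpoch_mod q 7 r = qpoch_mod q 14 r * qpoch_mod q 14 (r + 7)"
  using qpoch_mod_dissect[OF assms, of 7 2 r] by (simp add: prod_numeral mult_ac)

lemma qpoch_mod_14_28:
  assumes "norm q < 1"
  shows "qpoch_mod q 14 r = qpoch_mod q 28 r * qpoch_mod q 28 (r + 14)"
  using qpoch_mod_dissect[OF assms, of 14 2 r] by (simp add: prod_numeral mult_ac)

lemma qpoch_mod_7_28:
  assumes "norm q < 1"
  shows "qpoch_mod q 7 r = qpoch_mod q 28 r * qpoch_mod q 28 (r + 7) * qpoch_mod q 28 (r + 14) * qpoch_mod q 28 (r + 21)"
  using qpoch_mod_dissect[OF assms, of 7 4 r] by (simp add: prod_numeral mult_ac)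

lemma qpoch_mod_double: "qpoch_mod p (2 * N) (2 * r) = qpoch_mod (p ^ 2) N r"
  by (simp add: qpoch_mod_def power_mult)

lemma qpoch_inf_minus_mod:
  assumes "norm q < 1" "N > 0" "r > 0"
  shows "qpoch_inf (- (q ^ r)) (q ^ N) = qpoch_mod q (2 * N) (2 * r) / qpoch_mod q N r"
proof -
  have "norm (q ^ N) < 1" using assms by (simp add: norm_power power_less_one_iff)
  from qpoch_inf_mult_minus[OF this, of "q ^ r"]
  have "qpoch_mod q N r * qpoch_inf (- (q ^ r)) (q ^ N) = qpoch_mod q (2 * N) (2 * r)"
    unfolding qpoch_mod_def by (simp add: power_mult power_mult_distrib flip: power_mult) (simp add: mult.commute)
  then show ?thesis using qpoch_mod_nonzero[OF assms] by (simp add: field_simps)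
qed

lemma theta_plus_14:
  assumes q: "norm q < 1" and c: "0 < c" "c < 14"
  shows "theta_plus q 14 c = qpoch_mod q 28 (2 * c) * qpoch_mod q 28 (28 - 2 * c) * qpoch_mod q 14 14 /
    (qpoch_mod q 14 c * qpoch_mod q 14 (14 - c))"
  using qpoch_inf_minus_mod[OF q, of 14 c] qpoch_inf_minus_mod[OF q, of 14 "14 - c"] c
  by (simp add: theta_plus_def qpoch_mod_def[of q 14 14] diff_mult_distrib2)

lemma theta7_mod14:
  assumes p: "norm p < 1" and c: "c \<le> 7"
  shows "theta7 p c = qpoch_mod p 14 c * qpoch_mod p 14 (c + 7) * (qpoch_mod p 14 (7 - c) * qpoch_mod p 14 (14 - c))
    * (qpoch_mod p 14 7 * qpoch_mod p 14 14)"
  using qpoch_mod_7_14[OF p, of c] qpoch_mod_7_14[OF p, of "7 - c"] qpoch_mod_7_14[OF p, of 7] c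
  by (simp add: theta7_def qpoch_mod_def[of p 7])

context
  fixes p :: complex
  assumes p: "norm p < 1" "p \<noteq> 0"
begin

text \<open>\<open>X\<close> still sees the sign of p at odd residues; \<open>P\<close> depends on
  p^2 only. Modulus 28 is the common refinement of the moduli 7, 14 and 28 that occur in base
  p^2.\<close>

abbreviation (input) "X \<equiv> qpoch_mod p 14"
abbreviation (input) "P \<equiv> qpoch_mod (p ^ 2) 28"

lemma X_even: "X (2 * r) = P r * P (r + 7) * P (r + 14) * P (r + 21)"
  using qpoch_mod_double[of p 7 r] qpoch_mod_7_28[OF norm_p2(1)[OF p], of r] by simp

lemma theta_plus_p_14:
  assumes "0 < c" "c < 14"
  shows "theta_plus p 14 c * (X c * X (14 - c)) = P c * P (c + 14) * P (14 - c) * P (28 - c) * X 14"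
proof -
  have "qpoch_mod p 28 (2 * c) = P c * P (c + 14)"
    using qpoch_mod_double[of p 14 c] qpoch_mod_14_28[OF norm_p2(1)[OF p], of c] by simp
  moreover have "qpoch_mod p 28 (28 - 2 * c) = P (14 - c) * P (28 - c)"
    using qpoch_mod_double[of p 14 "14 - c"] qpoch_mod_14_28[OF norm_p2(1)[OF p], of "14 - c"] assms
    by (simp add: diff_mult_distrib2)
  moreover have "X c \<noteq> 0" "X (14 - c) \<noteq> 0"
    using qpoch_mod_nonzero[OF p(1)] assms by simp_all
  ultimately show ?thesis
    unfolding theta_plus_14[OF p(1) assms] by (simp add: field_simps)
qed

lemma theta_plus_q_14:
  assumes "0 < c" "c < 14"
  shows "theta_plus (p ^ 2) 14 c = P (2 * c) * P (28 - 2 * c) * (P 14 * P 28) /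
    (P c * P (c + 14) * (P (14 - c) * P (28 - c)))"
  using qpoch_mod_14_28[OF norm_p2(1)[OF p], of c] qpoch_mod_14_28[OF norm_p2(1)[OF p], of "14 - c"]
    qpoch_mod_14_28[OF norm_p2(1)[OF p], of 14] theta_plus_14[OF norm_p2(1)[OF p] assms] assms
  by simp

text \<open>The factors in \<open>X a\<close>, \<open>X b\<close> of odd index are completed to functions of \<open>p\<^sup>2\<close> by the factors with opposite
  sign, at the cost of a product of two theta functions, whose parity split is \<open>theta_plus_mult\<close>.\<close>

lemma dissection_step:
  assumes "0 < a" "a < 14" "0 < b" "b < 14" "e \<le> 14" "f \<le> 14" "g \<le> 14" "h \<le> 14"
    "2 * e = a + b" "2 * f + b = 14 + a" "2 * g = 14 + a + b" "2 * h + b = 28 + a"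
  shows "1 / (X a * X (14 - a) * (X b * X (14 - b)) * V) =
    (theta_plus (p ^ 2) 14 e * theta_plus (p ^ 2) 14 f + p ^ a * (theta_plus (p ^ 2) 14 g * theta_plus (p ^ 2) 14 h)) /
    ((P a * P (a + 14) * P (14 - a) * P (28 - a) * X 14) * (P b * P (b + 14) * P (14 - b) * P (28 - b) * X 14) * V)"
proof -
  have X0: "X r \<noteq> 0" and P0: "P r \<noteq> 0" if "r > 0" for r
    using that qpoch_mod_nonzero[OF p(1)] qpoch_mod_nonzero[OF norm_p2(1)[OF p]] by simp_all
  have "theta_plus p 14 a \<noteq> 0" "theta_plus p 14 b \<noteq> 0"
    using theta_plus_p_14[of a] theta_plus_p_14[of b] X0 P0 assms by auto
  then have "1 / (X a * X (14 - a) * (X b * X (14 - b)) * V) = (theta_plus p 14 a * theta_plus p 14 b) /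
      ((theta_plus p 14 a * (X a * X (14 - a))) * (theta_plus p 14 b * (X b * X (14 - b))) * V)"
    by simp
  also have "theta_plus p 14 a * theta_plus p 14 b = theta_plus (p ^ 2) 14 e * theta_plus (p ^ 2) 14 f
      + p ^ a * (theta_plus (p ^ 2) 14 g * theta_plus (p ^ 2) 14 h)"
    by (rule theta_plus_mult[OF p]) (use assms in auto)
  finally show ?thesis
    using theta_plus_p_14 assms by simp
qed

text \<open>\<open>theta7 p 3\<close> cancels the residues 3, 4, 7, 10, 11, 14 modulo 14. The odd
  survivors are 1, 13 and 5, 9, so a = 1 and b = 5, which forces the indices 3, 5, 10, 12.\<close>

lemma dissection_3:
  "theta7 p 3 / qpoch_inf p p =
     1 / (qpoch_inf (p ^ 2) ((p ^ 2) ^ 2) ^ 2 * (P 4 * P 8 * P 20 * P 24))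
     + p * (P 8 * P 20 * P 14 * P 28 / (qpoch_inf (p ^ 2) (p ^ 2) * (P 1 * P 7 * P 10 * P 13 * P 15 * P 18 * P 21 * P 27)))"
proof -
  have nz: "X r \<noteq> 0" "P r \<noteq> 0" if "r > 0" for r
    using that qpoch_mod_nonzero[OF p(1)] qpoch_mod_nonzero[OF norm_p2(1)[OF p]] by simp_all
  have "theta7 p 3 / qpoch_inf p p = 1 / (X 1 * X 13 * (X 5 * X 9) * (X 2 * X 6 * X 8 * X 12))"
    unfolding theta7_mod14[OF p(1), of 3, simplified] qpoch_inf_mod14[OF p(1)]
    using nz by (simp add: field_simps)
  also have "\<dots> = (theta_plus (p ^ 2) 14 3 * theta_plus (p ^ 2) 14 5 + p ^ 1 * (theta_plus (p ^ 2) 14 10 * theta_plus (p ^ 2) 14 12)) /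
      ((P 1 * P 15 * P 13 * P 27 * X 14) * (P 5 * P 19 * P 9 * P 23 * X 14) * (X 2 * X 6 * X 8 * X 12))"
    using dissection_step[of 1 5 3 5 10 12 "X 2 * X 6 * X 8 * X 12"] by simp
  also have "\<dots> = 1 / (qpoch_inf (p ^ 2) ((p ^ 2) ^ 2) ^ 2 * (P 4 * P 8 * P 20 * P 24)) + p * (P 8 * P 20 * P 14 * P 28 / (qpoch_inf (p ^ 2) (p ^ 2) * (P 1 * P 7 * P 10 * P 13 * P 15 * P 18 * P 21 * P 27)))"
    unfolding X_even[of 1, simplified] X_even[of 3, simplified] X_even[of 4, simplified] X_even[of 6, simplified] X_even[of 7, simplified] theta_plus_q_14[of 3, simplified] theta_plus_q_14[of 5, simplified] theta_plus_q_14[of 10, simplified] theta_plus_q_14[of 12, simplified]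
      qpoch_inf_mod28[OF norm_p2(1)[OF p]] qpoch_inf_odd_mod28[OF norm_p2(1)[OF p]]
      add_divide_distrib power_one_right
  proof (intro arg_cong2[where f = "(+)"], goal_cases)
    case 1
    show ?case
      using nz by (simp add: divide_simps) (simp add: power2_eq_square mult_ac)?
  next
    case 2
    show ?case unfolding times_divide_eq_right[symmetric]
      using nz by (simp add: divide_simps) (simp add: power2_eq_square mult_ac)?
  qed
  finally show ?thesis .
qed

text \<open>Now the odd survivors are 1, 13 and 3, 11, so a = 1 and b = 3.\<close>

lemma dissection_5:
  "theta7 p 5 / qpoch_inf p p =
     P 4 * P 24 * P 14 * P 28 / (qpoch_inf (p ^ 2) (p ^ 2) * (P 2 * P 3 * P 7 * P 11 * P 17 * P 21 * P 25 * P 26))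
     + p * (1 / (qpoch_inf (p ^ 2) ((p ^ 2) ^ 2) ^ 2 * (P 4 * P 12 * P 16 * P 24)))"
proof -
  have nz: "X r \<noteq> 0" "P r \<noteq> 0" if "r > 0" for r
    using that qpoch_mod_nonzero[OF p(1)] qpoch_mod_nonzero[OF norm_p2(1)[OF p]] by simp_all
  have "theta7 p 5 / qpoch_inf p p = 1 / (X 1 * X 13 * (X 3 * X 11) * (X 4 * X 6 * X 8 * X 10))"
    unfolding theta7_mod14[OF p(1), of 5, simplified] qpoch_inf_mod14[OF p(1)]
    using nz by (simp add: field_simps)
  also have "\<dots> = (theta_plus (p ^ 2) 14 2 * theta_plus (p ^ 2) 14 6 + p ^ 1 * (theta_plus (p ^ 2) 14 9 * theta_plus (p ^ 2) 14 13)) /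
      ((P 1 * P 15 * P 13 * P 27 * X 14) * (P 3 * P 17 * P 11 * P 25 * X 14) * (X 4 * X 6 * X 8 * X 10))"
    using dissection_step[of 1 3 2 6 9 13 "X 4 * X 6 * X 8 * X 10"] by simp
  also have "\<dots> = P 4 * P 24 * P 14 * P 28 / (qpoch_inf (p ^ 2) (p ^ 2) * (P 2 * P 3 * P 7 * P 11 * P 17 * P 21 * P 25 * P 26)) + p * (1 / (qpoch_inf (p ^ 2) ((p ^ 2) ^ 2) ^ 2 * (P 4 * P 12 * P 16 * P 24)))"
    unfolding X_even[of 2, simplified] X_even[of 3, simplified] X_even[of 4, simplified] X_even[of 5, simplified] X_even[of 7, simplified] theta_plus_q_14[of 2, simplified] theta_plus_q_14[of 6, simplified] theta_plus_q_14[of 9, simplified] theta_plus_q_14[of 13, simplified]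
      qpoch_inf_mod28[OF norm_p2(1)[OF p]] qpoch_inf_odd_mod28[OF norm_p2(1)[OF p]]
      add_divide_distrib power_one_right
  proof (intro arg_cong2[where f = "(+)"], goal_cases)
    case 1
    show ?case
      using nz by (simp add: divide_simps) (simp add: power2_eq_square mult_ac)?
  next
    case 2
    show ?case unfolding times_divide_eq_right[symmetric]
      using nz by (simp add: divide_simps) (simp add: power2_eq_square mult_ac)?
  qed
  finally show ?thesis .
qed

text \<open>Residues 1 and 13 are cancelled here and 3, 11 and 5, 9 survive; a = 3 is why the odd
  part carries p^3.\<close>

lemma dissection_6:
  "theta7 p 6 / qpoch_inf p p =
     P 12 * P 16 * P 14 * P 28 / (qpoch_inf (p ^ 2) (p ^ 2) * (P 5 * P 6 * P 7 * P 9 * P 19 * P 21 * P 22 * P 23))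
     + p ^ 3 * (1 / (qpoch_inf (p ^ 2) ((p ^ 2) ^ 2) ^ 2 * (P 8 * P 12 * P 16 * P 20)))"
proof -
  have nz: "X r \<noteq> 0" "P r \<noteq> 0" if "r > 0" for r
    using that qpoch_mod_nonzero[OF p(1)] qpoch_mod_nonzero[OF norm_p2(1)[OF p]] by simp_all
  have "theta7 p 6 / qpoch_inf p p = 1 / (X 3 * X 11 * (X 5 * X 9) * (X 2 * X 4 * X 10 * X 12))"
    unfolding theta7_mod14[OF p(1), of 6, simplified] qpoch_inf_mod14[OF p(1)]
    using nz by (simp add: field_simps)
  also have "\<dots> = (theta_plus (p ^ 2) 14 4 * theta_plus (p ^ 2) 14 6 + p ^ 3 * (theta_plus (p ^ 2) 14 11 * theta_plus (p ^ 2) 14 13)) /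
      ((P 3 * P 17 * P 11 * P 25 * X 14) * (P 5 * P 19 * P 9 * P 23 * X 14) * (X 2 * X 4 * X 10 * X 12))"
    using dissection_step[of 3 5 4 6 11 13 "X 2 * X 4 * X 10 * X 12"] by simp
  also have "\<dots> = P 12 * P 16 * P 14 * P 28 / (qpoch_inf (p ^ 2) (p ^ 2) * (P 5 * P 6 * P 7 * P 9 * P 19 * P 21 * P 22 * P 23)) + p ^ 3 * (1 / (qpoch_inf (p ^ 2) ((p ^ 2) ^ 2) ^ 2 * (P 8 * P 12 * P 16 * P 20)))"
    unfolding X_even[of 1, simplified] X_even[of 2, simplified] X_even[of 5, simplified] X_even[of 6, simplified] X_even[of 7, simplified] theta_plus_q_14[of 4, simplified] theta_plus_q_14[of 6, simplified] theta_plus_q_14[of 11, simplified] theta_plus_q_14[of 13, simplified]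
      qpoch_inf_mod28[OF norm_p2(1)[OF p]] qpoch_inf_odd_mod28[OF norm_p2(1)[OF p]]
      add_divide_distrib power_one_right
  proof (intro arg_cong2[where f = "(+)"], goal_cases)
    case 1
    show ?case
      using nz by (simp add: divide_simps) (simp add: power2_eq_square mult_ac)?
  next
    case 2
    show ?case unfolding times_divide_eq_right[symmetric]
      using nz by (simp add: divide_simps) (simp add: power2_eq_square mult_ac)?
  qed
  finally show ?thesis .
qed

end

section \<open>Comparison of even and odd parts\<close>

lemma parity_terms:
  fixes p :: complex
  assumes p: "norm p < 1" "p \<noteq> 0" and d: "d \<le> 1"
    and "theta7 p (3 + 2 * d) / qpoch_inf p p = E + p * D"
    and "theta7 (- p) (3 + 2 * d) / qpoch_inf (- p) (- p) = E - p * D"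
  shows "((\<lambda>(i, j). (p ^ 2) ^ (i ^ 2 + 2 * i * j + d * i + j) / (qpoch (p ^ 2) (p ^ 2) (2 * i) * qpoch (p ^ 2) (p ^ 2) (2 * j))) has_sum E) UNIV"
    and "((\<lambda>(i, j). (p ^ 2) ^ (i ^ 2 + 2 * i * j + (d + 1) * i + j) / (qpoch (p ^ 2) (p ^ 2) (2 * i) * qpoch (p ^ 2) (p ^ 2) (2 * j + 1))) has_sum D) UNIV"
proof -
  let ?u = "\<lambda>i. (p ^ 2) ^ (i ^ 2 + d * i) * (1 / qpoch (p ^ 2) (p ^ 2) (2 * i))"
  have p': "norm (- p) < 1" "- p \<noteq> 0" using p by auto
  have plus: "((\<lambda>(i, m). ?u i * ((p * (p ^ 2) ^ i) ^ m / qpoch (p ^ 2) (p ^ 2) m)) has_sum E + p * D) UNIV"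
    using rogers_selberg_double[OF p d] unfolding assms(4) .
  have minus: "((\<lambda>(i, m). ?u i * ((- p * (p ^ 2) ^ i) ^ m / qpoch (p ^ 2) (p ^ 2) m)) has_sum E - p * D) UNIV"
    using rogers_selberg_double[OF p' d] unfolding assms(5) power2_minus .
  have "?u i * ((p * (p ^ 2) ^ i) ^ (2 * j) / qpoch (p ^ 2) (p ^ 2) (2 * j)) =
      (p ^ 2) ^ (i ^ 2 + 2 * i * j + d * i + j) / (qpoch (p ^ 2) (p ^ 2) (2 * i) * qpoch (p ^ 2) (p ^ 2) (2 * j))" for i j
    by (simp add: power_add power_mult_distrib mult_ac flip: power_mult)
  then show "((\<lambda>(i, j). (p ^ 2) ^ (i ^ 2 + 2 * i * j + d * i + j) / (qpoch (p ^ 2) (p ^ 2) (2 * i) * qpoch (p ^ 2) (p ^ 2) (2 * j))) has_sum E) UNIV"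
    using parity_split(1)[OF p(2) plus minus] by (simp only:)
  have "?u i * (p ^ (2 * j) * ((p ^ 2) ^ i) ^ (2 * j + 1) / qpoch (p ^ 2) (p ^ 2) (2 * j + 1)) =
      (p ^ 2) ^ (i ^ 2 + 2 * i * j + (d + 1) * i + j) / (qpoch (p ^ 2) (p ^ 2) (2 * i) * qpoch (p ^ 2) (p ^ 2) (2 * j + 1))" for i j
    by (simp add: power_add mult_ac algebra_simps flip: power_mult)
  then show "((\<lambda>(i, j). (p ^ 2) ^ (i ^ 2 + 2 * i * j + (d + 1) * i + j) / (qpoch (p ^ 2) (p ^ 2) (2 * i) * qpoch (p ^ 2) (p ^ 2) (2 * j + 1))) has_sum D) UNIV"
    using parity_split(2)[OF p(2) plus minus] by (simp only:)
qed

text \<open>The odd terms carry p from the odd power and a further p^2 from the shift in q^(i + 1);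
  together they match the p^3 of \<open>dissection_6\<close>.\<close>

lemma parity_terms':
  fixes p :: complex
  assumes p: "norm p < 1" "p \<noteq> 0"
    and "theta7 p 6 / qpoch_inf p p = E + p ^ 3 * D"
    and "theta7 (- p) 6 / qpoch_inf (- p) (- p) = E - p ^ 3 * D"
  shows "((\<lambda>(i, j). (p ^ 2) ^ (i ^ 2 + 2 * i * j + i + 3 * j) / (qpoch (p ^ 2) (p ^ 2) (2 * i + 1) * qpoch (p ^ 2) (p ^ 2) (2 * j))) has_sum E) UNIV"
    and "((\<lambda>(i, j). (p ^ 2) ^ (i ^ 2 + 2 * i * j + 2 * i + 3 * j) / (qpoch (p ^ 2) (p ^ 2) (2 * i + 1) * qpoch (p ^ 2) (p ^ 2) (2 * j + 1))) has_sum D) UNIV"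
proof -
  let ?u = "\<lambda>i. (p ^ 2) ^ (i ^ 2 + 1 * i) * (1 / qpoch (p ^ 2) (p ^ 2) (2 * i + 1))"
  have p': "norm (- p) < 1" "- p \<noteq> 0" using p by auto
  have p3: "p ^ 3 * D = p * (p ^ 2 * D)"
    by (simp add: power3_eq_cube power2_eq_square)
  have plus: "((\<lambda>(i, m). ?u i * ((p * (p ^ 2) ^ (i + 1)) ^ m / qpoch (p ^ 2) (p ^ 2) m)) has_sum E + p * (p ^ 2 * D)) UNIV"
    using rogers_selberg_double'[OF p] unfolding assms(3) p3 .
  have minus: "((\<lambda>(i, m). ?u i * ((- p * (p ^ 2) ^ (i + 1)) ^ m / qpoch (p ^ 2) (p ^ 2) m)) has_sum E - p * (p ^ 2 * D)) UNIV"
    using rogers_selberg_double'[OF p'] unfolding assms(4) p3 power2_minus .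
  have "?u i * ((p * (p ^ 2) ^ (i + 1)) ^ (2 * j) / qpoch (p ^ 2) (p ^ 2) (2 * j)) =
      (p ^ 2) ^ (i ^ 2 + 2 * i * j + i + 3 * j) / (qpoch (p ^ 2) (p ^ 2) (2 * i + 1) * qpoch (p ^ 2) (p ^ 2) (2 * j))" for i j
  proof -
    have "(p ^ 2) ^ (i ^ 2 + 1 * i) * (p * (p ^ 2) ^ (i + 1)) ^ (2 * j) = p ^ (2 * (i ^ 2 + 1 * i) + (1 + 2 * (i + 1)) * (2 * j))"
      by (simp only: power_add power_mult power_one_right)
    also have "2 * (i ^ 2 + 1 * i) + (1 + 2 * (i + 1)) * (2 * j) = 2 * (i ^ 2 + 2 * i * j + i + 3 * j)"
      by (simp add: algebra_simps)
    also have "p ^ \<dots> = (p ^ 2) ^ (i ^ 2 + 2 * i * j + i + 3 * j)"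
      by (rule power_mult)
    finally have e: "(p ^ 2) ^ (i ^ 2 + 1 * i) * (p * (p ^ 2) ^ (i + 1)) ^ (2 * j) = \<dots>" .
    have "a * (1 / x) * (b / y) = a * b / (x * y)" for a b x y :: complex
      by simp
    then show ?thesis unfolding e[symmetric] .
  qed
  then show "((\<lambda>(i, j). (p ^ 2) ^ (i ^ 2 + 2 * i * j + i + 3 * j) / (qpoch (p ^ 2) (p ^ 2) (2 * i + 1) * qpoch (p ^ 2) (p ^ 2) (2 * j))) has_sum E) UNIV"
    using parity_split(1)[OF p(2) plus minus] by (simp only:)
  have "?u i * (p ^ (2 * j) * ((p ^ 2) ^ (i + 1)) ^ (2 * j + 1) / qpoch (p ^ 2) (p ^ 2) (2 * j + 1)) =
      p ^ 2 * ((p ^ 2) ^ (i ^ 2 + 2 * i * j + 2 * i + 3 * j) / (qpoch (p ^ 2) (p ^ 2) (2 * i + 1) * qpoch (p ^ 2) (p ^ 2) (2 * j + 1)))" for i j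
  proof -
    have "(p ^ 2) ^ (i ^ 2 + 1 * i) * (p ^ (2 * j) * ((p ^ 2) ^ (i + 1)) ^ (2 * j + 1)) =
        p ^ (2 * (i ^ 2 + 1 * i) + (2 * j + 2 * (i + 1) * (2 * j + 1)))"
      by (simp only: power_add power_mult)
    also have "2 * (i ^ 2 + 1 * i) + (2 * j + 2 * (i + 1) * (2 * j + 1)) = 2 + 2 * (i ^ 2 + 2 * i * j + 2 * i + 3 * j)"
      by (simp add: algebra_simps)
    also have "p ^ \<dots> = p ^ 2 * (p ^ 2) ^ (i ^ 2 + 2 * i * j + 2 * i + 3 * j)"
      by (simp only: power_add power_mult)
    finally have e: "(p ^ 2) ^ (i ^ 2 + 1 * i) * (p ^ (2 * j) * ((p ^ 2) ^ (i + 1)) ^ (2 * j + 1)) = \<dots>" .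
    have "a * (1 / x) * (b / y) = c * (d / (x * y))" if "a * b = c * d" for a b c d x y :: complex
      using that by simp
    then show ?thesis using e .
  qed
  then have "((\<lambda>(i, j). p ^ 2 * ((p ^ 2) ^ (i ^ 2 + 2 * i * j + 2 * i + 3 * j) / (qpoch (p ^ 2) (p ^ 2) (2 * i + 1) * qpoch (p ^ 2) (p ^ 2) (2 * j + 1)))) has_sum p ^ 2 * D) UNIV"
    using parity_split(2)[OF p(2) plus minus] by (simp only:)
  from has_sum_cmult_right[OF this, of "inverse (p ^ 2)"]
  show "((\<lambda>(i, j). (p ^ 2) ^ (i ^ 2 + 2 * i * j + 2 * i + 3 * j) / (qpoch (p ^ 2) (p ^ 2) (2 * i + 1) * qpoch (p ^ 2) (p ^ 2) (2 * j + 1))) has_sum D) UNIV"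
    using p by (simp add: case_prod_unfold flip: mult.assoc)
qed

lemma has_sum_at_0:
  fixes f :: "nat \<times> nat \<Rightarrow> complex"
  assumes "\<And>i j. f (i, j) = (if i = 0 \<and> j = 0 then 1 else 0)" "S = 1"
  shows "(f has_sum S) UNIV"
  by (rule has_sum_finite_neutralI[of "{(0, 0)}"]) (use assms in \<open>auto split: if_splits\<close>)

lemma qpoch_inf_0 [simp]: "qpoch_inf 0 q = 1"
  by (simp add: qpoch_inf_def)

lemma qpoch_0_left [simp]: "qpoch 0 q n = 1"
  by (simp add: qpoch_def)

theorem theorem3p5:
  fixes q :: complex
  assumes "norm q < 1"
  shows
    "((\<lambda>(i, j). q ^ (i ^ 2 + 2 * i * j + j) / (qpoch q q (2 * i) * qpoch q q (2 * j)))
        has_sum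
        (1 / (qpoch_inf q (q ^ 2) ^ 2 * qpochs_inf [q ^ 4, q ^ 8, q ^ 20, q ^ 24] (q ^ 28))))
       (UNIV :: (nat \<times> nat) set)
     \<and>
     ((\<lambda>(i, j). q ^ (i ^ 2 + 2 * i * j + i + j) / (qpoch q q (2 * i) * qpoch q q (2 * j + 1)))
        has_sum
        (qpochs_inf [q ^ 8, q ^ 20, q ^ 14, q ^ 28] (q ^ 28) /
           (qpoch_inf q q * qpochs_inf [q, q ^ 7, q ^ 10, q ^ 13, q ^ 15, q ^ 18, q ^ 21, q ^ 27] (q ^ 28))))
       (UNIV :: (nat \<times> nat) set)
     \<and>
     ((\<lambda>(i, j). q ^ (i ^ 2 + 2 * i * j + i + j) / (qpoch q q (2 * i) * qpoch q q (2 * j)))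
        has_sum
        (qpochs_inf [q ^ 4, q ^ 24, q ^ 14, q ^ 28] (q ^ 28) /
           (qpoch_inf q q * qpochs_inf [q ^ 2, q ^ 3, q ^ 7, q ^ 11, q ^ 17, q ^ 21, q ^ 25, q ^ 26] (q ^ 28))))
       (UNIV :: (nat \<times> nat) set)
     \<and>
     ((\<lambda>(i, j). q ^ (i ^ 2 + 2 * i * j + 2 * i + j) / (qpoch q q (2 * i) * qpoch q q (2 * j + 1)))
        has_sum
        (1 / (qpoch_inf q (q ^ 2) ^ 2 * qpochs_inf [q ^ 4, q ^ 12, q ^ 16, q ^ 24] (q ^ 28))))
       (UNIV :: (nat \<times> nat) set)
     \<and>
     ((\<lambda>(i, j). q ^ (i ^ 2 + 2 * i * j + i + 3 * j) / (qpoch q q (2 * i + 1) * qpoch q q (2 * j)))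
        has_sum
        (qpochs_inf [q ^ 12, q ^ 16, q ^ 14, q ^ 28] (q ^ 28) /
           (qpoch_inf q q * qpochs_inf [q ^ 5, q ^ 6, q ^ 7, q ^ 9, q ^ 19, q ^ 21, q ^ 22, q ^ 23] (q ^ 28))))
       (UNIV :: (nat \<times> nat) set)
     \<and>
     ((\<lambda>(i, j). q ^ (i ^ 2 + 2 * i * j + 2 * i + 3 * j) / (qpoch q q (2 * i + 1) * qpoch q q (2 * j + 1)))
        has_sum
        (1 / (qpoch_inf q (q ^ 2) ^ 2 * qpochs_inf [q ^ 8, q ^ 12, q ^ 16, q ^ 20] (q ^ 28))))
       (UNIV :: (nat \<times> nat) set)"
proof (cases "q = 0")
  case True
  \<comment> \<open>All six exponents vanish only at i = j = 0, so each sum reduces to one term, and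
    every product equals 1. The main argument needs a nonzero p for its integer powers.\<close>
  show ?thesis
    unfolding True by (intro conjI has_sum_at_0) (auto simp: qpochs_inf_def power_0_left)
next
  case False
  define p where "p = csqrt q"
  have q: "q = p ^ 2" by (simp add: p_def)
  have p: "norm p < 1" "p \<noteq> 0"
  proof -
    have "norm p ^ 2 < 1" using assms unfolding q by (simp add: norm_power)
    then show "norm p < 1" by (simp add: power_less_one_iff)
    show "p \<noteq> 0" using False q by auto
  qed
  have p': "norm (- p) < 1" "- p \<noteq> 0" using p by auto
  \<comment> \<open>Apart from the explicit power of p, the dissections involve only p^2;
    instantiating them at -p therefore gives the same E and D with the odd part negated.\<close>
  note d3 = dissection_3[OF p] dissection_3[OF p', unfolded power2_minus mult_minus_left, folded diff_conv_add_uminus]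
  note d5 = dissection_5[OF p] dissection_5[OF p', unfolded power2_minus mult_minus_left, folded diff_conv_add_uminus]
  have cube: "(- p) ^ 3 = - (p ^ 3)" by simp
  note d6 = dissection_6[OF p] dissection_6[OF p', unfolded power2_minus cube mult_minus_left, folded diff_conv_add_uminus]
  note sums = parity_terms[OF p, of 0, simplified, OF d3] parity_terms[OF p, of 1, simplified, OF d5] parity_terms'[OF p d6]
  show ?thesis
    using sums unfolding q[symmetric] qpochs_inf_def qpoch_mod_def
    by (simp add: mult_ac add_ac)
qed

end
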